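(* The problem SubwordIneqAbsoluteness is undecidable. That is, there is no algorithm which, given a finite alphabet $\Sigma$ and a subword history $SH$ in $\Sigma$, decides whether $|w|_{SH} \ge 0$ holds for every word $w \in \Sigma^*$.
   Context: Let $\Sigma$ be a finite alphabet, $\Sigma^*$ the set of all words over $\Sigma$, including the empty word $\lambda$. For $u, w \in \Sigma^*$, $|w|_u$ denotes the number of occurrences of $u$ as a scattered subword of $w$. If $u = u_1 \cdots u_k$ and $w = w_1 \cdots w_n$ with $u_i, w_j \in \Sigma$, this is the number of index sequences $1 \le j_1 < \cdots < j_k \le n$ with $w_{j_i} = u_i$ for all $i$ (e.g. $|aab|_{ab} = 2$). By convention $|w|_\lambda = 1$ for every $w$. Subword histories in $\Sigma$ are formal expressions defined recursively, together with their value $|w|_{SH} \in \mathbb{Z}$ in a word $w \in \Sigma^*$. (i) Every word $u \in \Sigma^*$ (including $\lambda$) is a subword history, called a monomial, with value $|w|_u$ in $w$. (ii) If $SH_1, SH_2$ are subword histories with values $\alpha_1, \alpha_2$ in $w$, then $-(SH_1)$, $(SH_1) + (SH_2)$ and $(SH_1) \times (SH_2)$ are subword histories with respective values $-\alpha_1$, $\alpha_1 + \alpha_2$ and $\alpha_1 \alpha_2$ in $w$. *)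

theory Defs
  imports Main "HOL-Library.Nat_Bijection"
begin

section \<open>Subword histories\<close>

text \<open>
  The index sequence \<open>j\<^sub>1 < \<dots> < j\<^sub>k\<close> of an occurrence is a strictly increasing list of
  (zero-based) positions.
\<close>

definition occurrences :: "'a list \<Rightarrow> 'a list \<Rightarrow> nat list set" where
  "occurrences w u = {js. length js = length u \<and> sorted_wrt (<) js \<and>
     (\<forall>i<length u. js ! i < length w \<and> w ! (js ! i) = u ! i)}"

definition subword_count :: "'a list \<Rightarrow> 'a list \<Rightarrow> nat" where
  "subword_count w u = card (occurrences w u)"

datatype (letters: 'a) subword_history =
    Monomial "'a list"
  | Neg "'a subword_history"
  | Add "'a subword_history" "'a subword_history"
  | Mult "'a subword_history" "'a subword_history"

primrec sh_value :: "'a list \<Rightarrow> 'a subword_history \<Rightarrow> int" where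
  "sh_value w (Monomial u) = int (subword_count w u)"
| "sh_value w (Neg s) = - sh_value w s"
| "sh_value w (Add s t) = sh_value w s + sh_value w t"
| "sh_value w (Mult s t) = sh_value w s * sh_value w t"

lemma finite_occurrences: "finite (occurrences w u)"
proof (rule finite_subset)
  show "occurrences w u \<subseteq> {js. set js \<subseteq> {..<length w} \<and> length js = length u}"
    by (auto simp: occurrences_def in_set_conv_nth)
qed (simp add: finite_lists_length_eq)

lemma subword_count_Nil: "subword_count w [] = 1"
proof -
  have "occurrences w [] = {[]}"
    by (auto simp: occurrences_def)
  then show ?thesis
    by (simp add: subword_count_def)
qed

lemma subword_count_example:
  assumes "a \<noteq> b"
  shows "subword_count [a, a, b] [a, b] = 2"
proof -
  have "js = [0, 2] \<or> js = [1, 2]" if "js \<in> occurrences [a, a, b] [a, b]" for js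
  proof -
    obtain j k where js: "js = [j, k]"
      using \<open>js \<in> _\<close> by (auto simp: occurrences_def length_Suc_conv numeral_2_eq_2)
    have jk: "j < k" "k < 3" "[a, a, b] ! k = b"
      using \<open>js \<in> _\<close> by (auto simp: occurrences_def js All_less_Suc numeral_3_eq_3)
    from \<open>k < 3\<close> have "k = 0 \<or> k = 1 \<or> k = 2" by auto
    with jk assms have "k = 2" by auto
    with jk js show ?thesis by auto
  qed
  then have "occurrences [a, a, b] [a, b] = {[0, 2], [1, 2]}"
    by (auto simp: occurrences_def All_less_Suc numeral_2_eq_2)
  then show ?thesis
    by (simp add: subword_count_def)
qed


section \<open>Partial recursive functions\<close>

text \<open>
  \<open>computes f xs y\<close>: the partial recursive function described by \<open>f\<close> is defined at the
  argument tuple \<open>xs\<close> with value \<open>y\<close>. Arities are implicit in the length of \<open>xs\<close>; at a tuple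
  of unsuitable length a description is simply undefined. \<open>Zero\<close> serves as the constant zero
  function of every arity.
\<close>

datatype recf =
    Zero
  | Succ
  | Proj nat
  | Comp recf "recf list"
  | PrimRec recf recf
  | Mu recf

inductive computes :: "recf \<Rightarrow> nat list \<Rightarrow> nat \<Rightarrow> bool" where
  zero: "computes Zero xs 0"
| succ: "computes Succ [x] (Suc x)"
| proj: "i < length xs \<Longrightarrow> computes (Proj i) xs (xs ! i)"
| comp: "\<lbrakk>list_all2 (\<lambda>g y. computes g xs y) gs ys; computes f ys z\<rbrakk>
    \<Longrightarrow> computes (Comp f gs) xs z"
| primrec_0: "computes f xs y \<Longrightarrow> computes (PrimRec f g) (0 # xs) y"
| primrec_Suc: "\<lbrakk>computes (PrimRec f g) (n # xs) r; computes g (n # r # xs) y\<rbrakk>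
    \<Longrightarrow> computes (PrimRec f g) (Suc n # xs) y"
| mu: "\<lbrakk>computes f (n # xs) 0; \<forall>m<n. \<exists>y>0. computes f (m # xs) y\<rbrakk>
    \<Longrightarrow> computes (Mu f) xs n"

lemma computes_functional: "computes f xs y \<Longrightarrow> computes f xs z \<Longrightarrow> y = z"
proof (induction f xs y arbitrary: z rule: computes.induct)
  case (zero xs)
  then show ?case by (auto elim: computes.cases)
next
  case (succ x)
  then show ?case by (auto elim: computes.cases)
next
  case (proj i xs)
  from proj.prems show ?case by (auto elim: computes.cases)
next
  case (comp xs gs ys f z z')
  from comp.prems obtain ys' where
    ys': "list_all2 (\<lambda>g y. computes g xs y) gs ys'" "computes f ys' z'"
    by (auto elim: computes.cases)
  have "ys = ys'"
    using comp.IH(1) ys'(1) by (auto simp: list_all2_conv_all_nth intro!: nth_equalityI)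
  then show ?case using comp.IH(2) ys'(2) by auto
next
  case (primrec_0 f xs y g)
  from primrec_0.prems have "computes f xs z" by (auto elim: computes.cases)
  then show ?case by (rule primrec_0.IH)
next
  case (primrec_Suc f g n xs r y)
  from primrec_Suc.prems obtain r' where
    "computes (PrimRec f g) (n # xs) r'" "computes g (n # r' # xs) z"
    by (auto elim: computes.cases)
  then show ?case using primrec_Suc.IH by auto
next
  case (mu f n xs z)
  from mu.prems have z: "computes f (z # xs) 0" "\<forall>m<z. \<exists>y>0. computes f (m # xs) y"
    by (auto elim: computes.cases)
  show ?case
  proof (cases n z rule: linorder_cases)
    case less
    then show ?thesis using z(2) mu.IH(1) by fastforce
  next
    case greater
    then show ?thesis using z(1) mu.IH(2) by fastforce
  qed
qed

text \<open>
  A decision problem consists of a set \<open>I\<close> of instances, their encoding \<open>code\<close> as natural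
  numbers, and the property \<open>P\<close> in question. An algorithm has to halt with the correct answer
  on every instance in \<open>I\<close>; nothing is required of it on numbers that encode no instance.
\<close>

definition decidable_problem :: "('i \<Rightarrow> nat) \<Rightarrow> 'i set \<Rightarrow> ('i \<Rightarrow> bool) \<Rightarrow> bool" where
  "decidable_problem code I P \<longleftrightarrow>
     (\<exists>f. \<forall>x\<in>I. computes f [code x] (if P x then 1 else 0))"


section \<open>The absoluteness problem for subword inequalities\<close>

text \<open>
  Letters are natural numbers, so that instances are finite objects; every finite alphabet
  is of this kind up to renaming.
\<close>

type_synonym sh_instance = "nat set \<times> nat subword_history"

definition sh_instances :: "sh_instance set" where
  "sh_instances = {(\<Sigma>, s). finite \<Sigma> \<and> letters s \<subseteq> \<Sigma>}"

definition SubwordIneqAbsoluteness :: "sh_instance \<Rightarrow> bool" where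
  "SubwordIneqAbsoluteness = (\<lambda>(\<Sigma>, s). \<forall>w\<in>lists \<Sigma>. sh_value w s \<ge> 0)"

primrec sh_encode :: "nat subword_history \<Rightarrow> nat" where
  "sh_encode (Monomial u) = prod_encode (0, list_encode u)"
| "sh_encode (Neg s) = prod_encode (1, sh_encode s)"
| "sh_encode (Add s t) = prod_encode (2, prod_encode (sh_encode s, sh_encode t))"
| "sh_encode (Mult s t) = prod_encode (3, prod_encode (sh_encode s, sh_encode t))"

definition sh_instance_encode :: "sh_instance \<Rightarrow> nat" where
  "sh_instance_encode = (\<lambda>(\<Sigma>, s). prod_encode (set_encode \<Sigma>, sh_encode s))"

lemma sh_encode_eq_iff: "sh_encode s = sh_encode t \<longleftrightarrow> s = t"
proof (induction s arbitrary: t)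
  case (Monomial u)
  show ?case by (cases t) (auto simp: prod_encode_eq list_encode_eq)
next
  case (Neg s)
  then show ?case by (cases t) (auto simp: prod_encode_eq)
next
  case (Add s1 s2)
  then show ?case by (cases t) (auto simp: prod_encode_eq)
next
  case (Mult s1 s2)
  then show ?case by (cases t) (auto simp: prod_encode_eq)
qed

lemma inj_on_sh_instance_encode: "inj_on sh_instance_encode sh_instances"
  by (auto simp: inj_on_def sh_instances_def sh_instance_encode_def prod_encode_eq
      sh_encode_eq_iff dest: inj_onD[OF inj_on_set_encode])

end

theory Submission
  imports Defs
begin

text \<open>
  Counts of subwords in a word can be summed over the word: if \<open>h\<close> is (the value of) a subword
  history, then so is the sum of \<open>h v\<close> over all suffixes \<open>v\<close> preceded by a given letter. Taking
  for \<open>h\<close> the square of a quantity that has to vanish, one history can assert a condition at every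
  position of a word, so that it can express that the word is the trace of a run of a flowchart
  whose registers are differences of numbers of letters. For every partial recursive \<open>h\<close> this
  gives a history \<open>s\<close> that becomes negative, on a word with \<open>m\<close> letters 0 and \<open>n\<close> letters 1, iff
  \<open>h (m, n) = 1\<close>. A decision procedure leads to a contradiction by diagonalization: let \<open>h (m, n)\<close>
  decide the history with code \<open>n\<close> over the alphabet with code \<open>m\<close>, restricted to words with
  \<open>m\<close> letters 0 and \<open>n\<close> letters 1, and apply it to the code of the history for \<open>h\<close> itself.
\<close>

section \<open>Functions spanned by subword counts\<close>

text \<open>An occurrence of \<open>a # u\<close> either avoids position 0, and is then a shifted
  occurrence in \<open>w\<close>, or uses position 0. In the second case 0 is its first index, and
  the other indices form a shifted occurrence of \<open>u\<close>.\<close>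

lemma occurrences_Cons_Cons:
  "occurrences (x # w) (a # u) =
     map Suc ` occurrences w (a # u) \<union>
     (if x = a then (\<lambda>js. 0 # map Suc js) ` occurrences w u else {})"
  (is "?L = ?R")
proof (intro set_eqI iffI)
  fix js assume js: "js \<in> ?L"
  then obtain j ks where jks: "js = j # ks"
    by (auto simp: occurrences_def length_Suc_conv)
  have pos: "0 < k" if "k \<in> set ks" for k
    using js that by (auto simp: occurrences_def jks)
  \<comment> \<open>All indices after the first are positive, so subtracting 1 loses
    nothing.\<close>
  define ks' where "ks' = map (\<lambda>k. k - 1) ks"
  have ks: "ks = map Suc ks'"
    using pos by (auto simp: ks'_def intro!: map_idI[symmetric])
  have len: "length ks' = length u" and sorted: "sorted_wrt (<) ks'"
    using js by (auto simp: occurrences_def jks ks sorted_wrt_map)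
  have head: "j < Suc (length w)" "(x # w) ! j = a"
    using js by (auto simp: occurrences_def jks)
  have tail: "\<forall>i<length u. ks' ! i < length w \<and> w ! (ks' ! i) = u ! i"
  proof (intro allI impI)
    fix i assume "i < length u"
    then have "Suc i < length (a # u)" by simp
    with js have "js ! Suc i < length (x # w) \<and> (x # w) ! (js ! Suc i) = (a # u) ! Suc i"
      unfolding occurrences_def by blast
    then show "ks' ! i < length w \<and> w ! (ks' ! i) = u ! i"
      using \<open>i < length u\<close> len by (simp add: jks ks)
  qed
  show "js \<in> ?R"
  proof (cases j)
    case 0
    then have "x = a" using head by simp
    moreover have "ks' \<in> occurrences w u"
      using len sorted tail by (simp add: occurrences_def)
    ultimately show ?thesis using 0 by (auto simp: jks ks)
  next
    case (Suc j')
    have "j' # ks' \<in> occurrences w (a # u)"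
      using js len sorted head tail
      by (auto simp: occurrences_def jks ks Suc nth_Cons split: nat.split)
    then have "map Suc (j' # ks') \<in> ?R" by blast
    then show ?thesis by (simp add: jks ks Suc)
  qed
next
  fix js assume "js \<in> ?R"
  then consider (shift) ks where "js = map Suc ks" "ks \<in> occurrences w (a # u)"
    | (head) ks where "x = a" "js = 0 # map Suc ks" "ks \<in> occurrences w u"
    by (auto split: if_splits)
  then show "js \<in> ?L"
  proof cases
    case shift
    then show ?thesis by (auto simp: occurrences_def sorted_wrt_map)
  next
    case head
    then show ?thesis
      by (auto simp: occurrences_def sorted_wrt_map nth_Cons split: nat.split)
  qed
qed

lemma subword_count_Cons_Cons:
  "subword_count (x # w) (a # u) =
     subword_count w (a # u) + (if x = a then subword_count w u else 0)"
proof -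
  have inj: "inj_on (map Suc) S" "inj_on (\<lambda>js. 0 # map Suc js) S" for S
    by (auto intro!: inj_onI)
  have disj: "map Suc ` S \<inter> (\<lambda>js. 0 # map Suc js) ` S' = {}" for S S'
    by auto
  show ?thesis
    unfolding subword_count_def occurrences_Cons_Cons
    by (simp add: card_Un_disjoint disj card_image inj finite_occurrences)
qed

lemma subword_count_Nil_Cons: "subword_count [] (a # u) = 0"
proof -
  have "occurrences [] (a # u) = {}"
    by (auto simp: occurrences_def)
  then show ?thesis by (simp add: subword_count_def)
qed

text \<open>If all letters of the subword agree, the recursion on the first letter is Pascal's rule.
  The case \<open>n = 1\<close> makes letter counts available; general \<open>n\<close> serves to
  test for exactly \<open>n\<close> occurrences of a letter.\<close>

lemma subword_count_replicate:
  "subword_count w (replicate n a) = count_list w a choose n"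
proof (induction w arbitrary: n)
  case Nil
  then show ?case by (cases n) (simp_all add: subword_count_Nil subword_count_Nil_Cons)
next
  case (Cons x w)
  show ?case
  proof (cases n)
    case 0
    then show ?thesis by (simp add: subword_count_Nil)
  next
    case (Suc m)
    then show ?thesis
      using Cons.IH[of "Suc m"] Cons.IH[of m] by (simp add: subword_count_Cons_Cons)
  qed
qed

lemma choose_eq_1_iff:
  assumes "0 < n"
  shows "m choose n = 1 \<longleftrightarrow> m = n"
proof (cases m n rule: linorder_cases)
  case less
  then show ?thesis by (simp add: binomial_eq_0)
next
  case greater
  have "1 < m choose n"
  proof -
    obtain k where n: "n = Suc k" using assms gr0_implies_Suc by blast
    obtain l where m: "m = Suc l" using greater gr0_implies_Suc by (cases m) auto
    \<comment> \<open>Pascal's rule splits \<open>m choose n\<close> into these two positive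
      summands.\<close>
    have "0 < l choose k" "0 < l choose Suc k"
      using greater by (simp_all add: n m zero_less_binomial)
    then have "1 < (l choose k) + (l choose Suc k)" by linarith
    then show ?thesis by (simp add: n m)
  qed
  then show ?thesis using greater by auto
qed simp

section \<open>The additive group of subword functions and its closure properties\<close>

text \<open>Products are deliberately left out: summation over suffixes is easy for linear
  combinations of counts, and closure under multiplication is proved afterwards in
  \<open>subword_fun_mult\<close>.\<close>

inductive subword_fun :: "'a set \<Rightarrow> ('a list \<Rightarrow> int) \<Rightarrow> bool" for A where
  zero: "subword_fun A (\<lambda>w. 0)"
| count: "set u \<subseteq> A \<Longrightarrow> subword_fun A (\<lambda>w. int (subword_count w u))"
| add: "subword_fun A f \<Longrightarrow> subword_fun A g \<Longrightarrow> subword_fun A (\<lambda>w. f w + g w)"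
| neg: "subword_fun A f \<Longrightarrow> subword_fun A (\<lambda>w. - f w)"

lemma subword_fun_diff:
  "subword_fun A f \<Longrightarrow> subword_fun A g \<Longrightarrow> subword_fun A (\<lambda>w. f w - g w)"
  using subword_fun.add[OF _ subword_fun.neg] by fastforce

lemma subword_fun_if:
  "(P \<Longrightarrow> subword_fun A f) \<Longrightarrow> subword_fun A (\<lambda>w. if P then f w else 0)"
  by (cases P) (simp_all add: subword_fun.zero)

lemma subword_fun_const: "subword_fun A (\<lambda>w. c)"
proof (induction c rule: int_induct[where k = 0])
  case base
  show ?case by (rule subword_fun.zero)
next
  case (step1 i)
  show ?case
    using subword_fun.add[OF step1(2) subword_fun.count[of "[]"]] by (simp add: subword_count_Nil)
next
  case (step2 i)
  show ?case
    using subword_fun_diff[OF step2(2) subword_fun.count[of "[]"]] by (simp add: subword_count_Nil)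
qed

lemma subword_fun_sum:
  "finite I \<Longrightarrow> (\<And>i. i \<in> I \<Longrightarrow> subword_fun A (f i)) \<Longrightarrow> subword_fun A (\<lambda>w. \<Sum>i\<in>I. f i w)"
proof (induction I rule: finite_induct)
  case empty
  then show ?case by (simp add: subword_fun.zero)
next
  case (insert i I)
  then show ?case by (auto intro!: subword_fun.add)
qed

text \<open>For a single count of \<open>u\<close> the function sought is the count of
  \<open>a # u\<close>, because the leading \<open>a\<close> can be matched with each letter
  \<open>a\<close> of the word, and \<open>u\<close> is then counted in the suffix behind it. The
  rest is linearity.\<close>

lemma subword_fun_sum_suffixes:
  assumes "subword_fun A h" and "a \<in> A"
  obtains f where "subword_fun A f" "f [] = 0"
    "\<And>x w. f (x # w) = f w + (if x = a then h w else 0)"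
proof -
  have "\<exists>f. subword_fun A f \<and> f [] = 0 \<and> (\<forall>x w. f (x # w) = f w + (if x = a then h w else 0))"
    using assms(1)
  proof induction
    case zero
    show ?case by (rule exI[of _ "\<lambda>w. 0"]) (simp add: subword_fun.zero)
  next
    case (count u)
    show ?case
      using count \<open>a \<in> A\<close>
      by (intro exI[of _ "\<lambda>w. int (subword_count w (a # u))"])
        (simp add: subword_fun.count[of "a # u", simplified]
          subword_count_Nil_Cons subword_count_Cons_Cons)
  next
    case (add h1 h2)
    then obtain f1 f2 where
      "subword_fun A f1 \<and> f1 [] = 0 \<and> (\<forall>x w. f1 (x # w) = f1 w + (if x = a then h1 w else 0))"
      "subword_fun A f2 \<and> f2 [] = 0 \<and> (\<forall>x w. f2 (x # w) = f2 w + (if x = a then h2 w else 0))"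
      by blast
    then show ?case
      by (intro exI[of _ "\<lambda>w. f1 w + f2 w"]) (auto intro: subword_fun.add)
  next
    case (neg h)
    then obtain f where
      "subword_fun A f \<and> f [] = 0 \<and> (\<forall>x w. f (x # w) = f w + (if x = a then h w else 0))"
      by blast
    then show ?case
      by (intro exI[of _ "\<lambda>w. - f w"]) (auto intro: subword_fun.neg)
  qed
  then show ?thesis using that by blast
qed

text \<open>Up to the constant \<open>f []\<close>, the function is the sum over \<open>a\<close> in
  \<open>A\<close> of the suffix sums of \<open>h a\<close>. This is the tool for all quantities
  defined by recursion over a word.\<close>

lemma subword_fun_accumulate:
  assumes "finite A" and h: "\<And>x. x \<in> A \<Longrightarrow> subword_fun A (h x)"
    and f: "\<And>x w. f (x # w) = f w + (if x \<in> A then h x w else 0)"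
  shows "subword_fun A f"
proof -
  have "\<forall>a\<in>A. \<exists>F. subword_fun A F \<and> F [] = 0 \<and>
      (\<forall>x w. F (x # w) = F w + (if x = a then h a w else 0))"
    using h by (metis subword_fun_sum_suffixes)
  then obtain F where F: "\<And>a. a \<in> A \<Longrightarrow> subword_fun A (F a)" "\<And>a. a \<in> A \<Longrightarrow> F a [] = 0"
    "\<And>a x w. a \<in> A \<Longrightarrow> F a (x # w) = F a w + (if x = a then h a w else 0)"
    by metis
  have "f w = f [] + (\<Sum>a\<in>A. F a w)" for w
  proof (induction w)
    case Nil
    then show ?case by (simp add: F(2))
  next
    case (Cons x w)
    have "(\<Sum>a\<in>A. F a (x # w)) = (\<Sum>a\<in>A. F a w) + (\<Sum>a\<in>A. if x = a then h a w else 0)"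
      by (simp add: F(3) sum.distrib)
    then show ?case using Cons \<open>finite A\<close> by (simp add: f)
  qed
  then have "f = (\<lambda>w. f [] + (\<Sum>a\<in>A. F a w))" by blast
  moreover have "subword_fun A (\<lambda>w. f [] + (\<Sum>a\<in>A. F a w))"
    using \<open>finite A\<close> F(1) by (intro subword_fun.add subword_fun_const subword_fun_sum)
  ultimately show ?thesis by simp
qed

text \<open>
  The product of two subword counts satisfies the recursion of the infiltration product of the
  two words, so it is again an integer combination of subword counts.
\<close>

lemma subword_fun_count_mult:
  assumes "finite A" "set u \<subseteq> A" "set v \<subseteq> A"
  shows "subword_fun A (\<lambda>w. int (subword_count w u) * int (subword_count w v))"
  using assms(2,3)
proof (induction "length u + length v" arbitrary: u v rule: less_induct)
  case less
  show ?case
  proof (cases "u = [] \<or> v = []")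
    case True
    then show ?thesis
      using less.prems by (auto simp: subword_count_Nil intro: subword_fun.count)
  next
    case False
    then obtain a u' b v' where uv: "u = a # u'" "v = b # v'"
      by (meson neq_Nil_conv)
    let ?c = "\<lambda>u w. int (subword_count w u)"
    \<comment> \<open>These are the terms other than \<open>?c u w * ?c v w\<close> in the product
      of the two expanded counts of \<open>x # w\<close>. Each of them involves a pair of words of
      smaller total length.\<close>
    let ?h = "\<lambda>x w. (if x = a then ?c u' w * ?c v w else 0) + (if x = b then ?c u w * ?c v' w else 0)
        + (if x = a \<and> x = b then ?c u' w * ?c v' w else 0)"
    show ?thesis
    proof (rule subword_fun_accumulate[OF \<open>finite A\<close>, where h = ?h])
      fix x
      have "subword_fun A (\<lambda>w. ?c u' w * ?c v w)" "subword_fun A (\<lambda>w. ?c u w * ?c v' w)"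
        "subword_fun A (\<lambda>w. ?c u' w * ?c v' w)"
        using less.prems by (auto simp: uv intro!: less.hyps[unfolded uv])
      then show "subword_fun A (?h x)"
        by (intro subword_fun.add subword_fun_if)
    next
      fix x w
      show "?c u (x # w) * ?c v (x # w) = ?c u w * ?c v w + (if x \<in> A then ?h x w else 0)"
        using less.prems by (auto simp: uv subword_count_Cons_Cons algebra_simps)
    qed
  qed
qed

lemma subword_fun_mult:
  assumes "finite A" "subword_fun A f" "subword_fun A g"
  shows "subword_fun A (\<lambda>w. f w * g w)"
  using assms(2)
proof induction
  case (count u)
  from assms(3) show ?case
  proof induction
    case (count v)
    then show ?case using subword_fun_count_mult \<open>finite A\<close> \<open>set u \<subseteq> A\<close> by blast
  next
    case (add g1 g2)
    then show ?case by (simp add: algebra_simps subword_fun.add)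
  qed (simp_all add: subword_fun.intros)
next
  case (add f1 f2)
  then show ?case by (simp add: algebra_simps subword_fun.add)
qed (simp_all add: subword_fun.intros)

lemma subword_fun_power2:
  "finite A \<Longrightarrow> subword_fun A f \<Longrightarrow> subword_fun A (\<lambda>w. (f w)\<^sup>2)"
  by (simp add: power2_eq_square subword_fun_mult)

lemma subword_fun_letter: "a \<in> A \<Longrightarrow> subword_fun A (\<lambda>w. int (count_list w a))"
  using subword_fun.count[of "[a]" A] subword_count_replicate[of _ 1 a] by simp

lemma subword_fun_history:
  assumes "subword_fun A f"
  obtains s where "letters s \<subseteq> A" "\<And>w. sh_value w s = f w"
proof -
  have "\<exists>s. letters s \<subseteq> A \<and> (\<forall>w. sh_value w s = f w)"
    using assms
  proof induction
    case zero
    \<comment> \<open>The value 0 is written as 1 - 1, which uses no letter.\<close>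
    show ?case
      by (rule exI[of _ "Add (Monomial []) (Neg (Monomial []))"]) simp
  next
    case (count u)
    then show ?case by (intro exI[of _ "Monomial u"]) simp
  next
    case (add f g)
    then obtain s t where "letters s \<subseteq> A \<and> (\<forall>w. sh_value w s = f w)"
      "letters t \<subseteq> A \<and> (\<forall>w. sh_value w t = g w)"
      by blast
    then show ?case by (intro exI[of _ "Add s t"]) simp
  next
    case (neg f)
    then obtain s where "letters s \<subseteq> A \<and> (\<forall>w. sh_value w s = f w)"
      by blast
    then show ?case by (intro exI[of _ "Neg s"]) simp
  qed
  then show ?thesis using that by blast
qed

section \<open>Flowcharts\<close>

text \<open>Guards are confined to these functions because they turn into subword functions when the
  registers do. Subtraction suffices to generate all integer affine combinations, as
  \<open>f + g = f - (0 - g)\<close>.\<close>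

inductive affine :: "((nat \<Rightarrow> int) \<Rightarrow> int) \<Rightarrow> bool" where
  const: "affine (\<lambda>s. c)"
| reg: "affine (\<lambda>s. s r)"
| diff: "affine f \<Longrightarrow> affine g \<Longrightarrow> affine (\<lambda>s. f s - g s)"

text \<open>
  A transition \<open>(l, g, d, l')\<close> leads from label \<open>l\<close> to label \<open>l'\<close>; it is enabled if \<open>g\<close>
  vanishes in the current state, and it adds \<open>d\<close> to the state.
\<close>

type_synonym transition =
  "nat list \<times> ((nat \<Rightarrow> int) \<Rightarrow> int) \<times> (nat \<Rightarrow> int) \<times> nat list"

definition move :: "transition set \<Rightarrow> ((nat list \<times> (nat \<Rightarrow> int)) \<times> nat list \<times> (nat \<Rightarrow> int)) set" where
  "move T = {((l, s), (l', \<lambda>r. s r + d r)) | l s g d l'. (l, g, d, l') \<in> T \<and> g s = 0}"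

definition flowchart :: "transition set \<Rightarrow> bool" where
  "flowchart T \<longleftrightarrow> finite T \<and> (\<forall>(l, g, d, l')\<in>T. affine g)"

abbreviation "entry \<equiv> [0 :: nat]"
abbreviation "exit \<equiv> [1 :: nat]"

text \<open>A relation rather than a function: a flowchart may guess a value and check it later,
  since only the existence of a run matters.\<close>

definition computes_rel :: "transition set \<Rightarrow> ((nat \<Rightarrow> int) \<times> (nat \<Rightarrow> int)) set" where
  "computes_rel T = {(s, t). ((entry, s), (exit, t)) \<in> (move T)\<^sup>*}"

definition realizable :: "((nat \<Rightarrow> int) \<times> (nat \<Rightarrow> int)) set \<Rightarrow> bool" where
  "realizable R \<longleftrightarrow> (\<exists>T. flowchart T \<and> computes_rel T = R)"

text \<open>The tag in front makes labels of different copies disjoint. The tags 2 and 3 used below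
  also keep them apart from \<open>entry\<close> and \<open>exit\<close>.\<close>

definition relabel :: "nat \<Rightarrow> transition set \<Rightarrow> transition set" where
  "relabel k T = (\<lambda>(l, g, d, l'). (k # l, g, d, k # l')) ` T"

abbreviation skip :: "nat list \<Rightarrow> nat list \<Rightarrow> transition" where
  "skip l l' \<equiv> (l, \<lambda>s. 0, \<lambda>r. 0, l')"

lemma moveI: "(l, g, d, l') \<in> T \<Longrightarrow> g s = 0 \<Longrightarrow> ((l, s), (l', \<lambda>r. s r + d r)) \<in> move T"
  by (auto simp: move_def)

lemma move_skip: "skip l l' \<in> T \<Longrightarrow> ((l, s), (l', s)) \<in> move T"
  using moveI[of l "\<lambda>s. 0" "\<lambda>r. 0" l' T s] by simp

lemma moveE:
  assumes "((l, s), (l', s')) \<in> move T"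
  obtains g d where "(l, g, d, l') \<in> T" "g s = 0" "s' = (\<lambda>r. s r + d r)"
  using assms by (auto simp: move_def)

lemma flowchart_relabel: "flowchart T \<Longrightarrow> flowchart (relabel k T)"
  by (auto simp: flowchart_def relabel_def)

lemma flowchart_Un: "flowchart T \<Longrightarrow> flowchart T' \<Longrightarrow> flowchart (T \<union> T')"
  by (auto simp: flowchart_def)

lemma flowchart_insert: "affine g \<Longrightarrow> flowchart T \<Longrightarrow> flowchart (insert (l, g, d, l') T)"
  by (auto simp: flowchart_def)

lemma flowchart_empty: "flowchart {}"
  by (simp add: flowchart_def)

lemma rtrancl_move_relabel:
  assumes "((l, s), (l', s')) \<in> (move T)\<^sup>*" "relabel k T \<subseteq> T'"
  shows "((k # l, s), (k # l', s')) \<in> (move T')\<^sup>*"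
  using assms(1)
proof (induction rule: rtrancl_induct2)
  case (step m t m' t')
  then obtain g d where "(m, g, d, m') \<in> T" "g t = 0" "t' = (\<lambda>r. t r + d r)"
    by (auto elim: moveE)
  then have "((k # m, t), (k # m', t')) \<in> move T'"
    using assms(2) by (auto simp: relabel_def image_subset_iff intro!: moveI)
  then show ?case using step.IH by (rule rtrancl_into_rtrancl[rotated])
qed simp

section \<open>Closure of realizable relations under composition and iteration\<close>

lemma realizable_update:
  assumes "affine g"
  shows "realizable {(s, t). g s = 0 \<and> t = (\<lambda>r. s r + d r)}"
proof -
  let ?T = "{(entry, g, d, exit)}"
  have "((entry, s), (l, t)) \<in> (move ?T)\<^sup>* \<Longrightarrow>
      (l = entry \<and> t = s) \<or> (l = exit \<and> g s = 0 \<and> t = (\<lambda>r. s r + d r))" for s l t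
  proof (induction rule: rtrancl_induct2)
    case (step m t m' t')
    then show ?case by (auto elim!: moveE)
  qed simp
  moreover have "((entry, s), (exit, \<lambda>r. s r + d r)) \<in> (move ?T)\<^sup>*" if "g s = 0" for s
    using that by (auto intro!: r_into_rtrancl moveI)
  ultimately have "computes_rel ?T = {(s, t). g s = 0 \<and> t = (\<lambda>r. s r + d r)}"
    by (fastforce simp: computes_rel_def)
  moreover have "flowchart ?T"
    using assms by (simp add: flowchart_insert flowchart_empty)
  ultimately show ?thesis by (auto simp: realizable_def)
qed

text \<open>Disjoint copies of the two flowcharts are connected in series by moves that leave the
  state unchanged.\<close>

lemma realizable_relcomp:
  assumes "realizable R1" "realizable R2"
  shows "realizable (R1 O R2)"
proof -
  obtain T1 T2 where T1: "flowchart T1" "computes_rel T1 = R1"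
    and T2: "flowchart T2" "computes_rel T2 = R2"
    using assms by (auto simp: realizable_def)
  define T where "T = {skip entry (2 # entry), skip (2 # exit) (3 # entry), skip (3 # exit) exit}
      \<union> relabel 2 T1 \<union> relabel 3 T2"
  \<comment> \<open>The invariant describes, for each kind of label, the states reachable there from
    \<open>(entry, s)\<close>.\<close>
  let ?inv = "\<lambda>s l t. l = entry \<and> t = s \<or> l = exit \<and> (s, t) \<in> R1 O R2 \<or>
      (\<exists>m. l = 2 # m \<and> ((entry, s), (m, t)) \<in> (move T1)\<^sup>*) \<or>
      (\<exists>m s'. l = 3 # m \<and> (s, s') \<in> R1 \<and> ((entry, s'), (m, t)) \<in> (move T2)\<^sup>*)"
  have sound: "((entry, s), (l, t)) \<in> (move T)\<^sup>* \<Longrightarrow> ?inv s l t" for s l t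
  proof (induction rule: rtrancl_induct2)
    case (step m t m' t')
    from step.hyps(2) obtain g d where gd: "(m, g, d, m') \<in> T" "g t = 0" "t' = (\<lambda>r. t r + d r)"
      by (rule moveE)
    from gd(1) consider (in1) "m = entry" "m' = 2 # entry" "d = (\<lambda>r. 0)"
      | (mid) "m = 2 # exit" "m' = 3 # entry" "d = (\<lambda>r. 0)"
      | (leave) "m = 3 # exit" "m' = exit" "d = (\<lambda>r. 0)"
      | (left) k k' where "m = 2 # k" "m' = 2 # k'" "(k, g, d, k') \<in> T1"
      | (right) k k' where "m = 3 # k" "m' = 3 # k'" "(k, g, d, k') \<in> T2"
      by (auto simp: T_def relabel_def)
    then show ?case
    proof cases
      case in1
      then show ?thesis using step.IH gd by auto
    next
      case mid
      then show ?thesis using step.IH gd T1(2) by (auto simp: computes_rel_def)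
    next
      case leave
      then show ?thesis using step.IH gd T2(2) by (auto simp: computes_rel_def)
    next
      case left
      then have "((k, t), (k', t')) \<in> move T1" using gd by (auto intro: moveI)
      then show ?thesis using step.IH left by (auto intro: rtrancl_into_rtrancl)
    next
      case right
      then have "((k, t), (k', t')) \<in> move T2" using gd by (auto intro: moveI)
      then show ?thesis using step.IH right by (auto intro: rtrancl_into_rtrancl)
    qed
  qed simp
  have complete: "((entry, s), (exit, t)) \<in> (move T)\<^sup>*" if "(s, t) \<in> R1 O R2" for s t
  proof -
    from that T1 T2 obtain s' where
      "((entry, s), (exit, s')) \<in> (move T1)\<^sup>*" "((entry, s'), (exit, t)) \<in> (move T2)\<^sup>*"
      by (auto simp: computes_rel_def)
    then have "((2 # entry, s), (2 # exit, s')) \<in> (move T)\<^sup>*"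
      "((3 # entry, s'), (3 # exit, t)) \<in> (move T)\<^sup>*"
      by (auto intro!: rtrancl_move_relabel simp: T_def)
    moreover have "((entry, s), (2 # entry, s)) \<in> move T" "((2 # exit, s'), (3 # entry, s')) \<in> move T"
      "((3 # exit, t), (exit, t)) \<in> move T"
      by (auto intro!: move_skip simp: T_def)
    ultimately show ?thesis
      by (meson converse_rtrancl_into_rtrancl rtrancl_trans rtrancl.rtrancl_into_rtrancl)
  qed
  have "computes_rel T = R1 O R2"
    unfolding computes_rel_def
  proof (intro set_eqI iffI; clarify del: relcompE)
    fix s t assume "((entry, s), (exit, t)) \<in> (move T)\<^sup>*"
    from sound[OF this] show "(s, t) \<in> R1 O R2" by auto
  next
    fix s t assume "(s, t) \<in> R1 O R2"
    then show "((entry, s), (exit, t)) \<in> (move T)\<^sup>*" by (rule complete)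
  qed
  moreover have "flowchart T"
    unfolding T_def using T1(1) T2(1)
    by (intro flowchart_Un flowchart_relabel flowchart_insert flowchart_empty affine.const)
  ultimately show ?thesis by (auto simp: realizable_def)
qed

text \<open>From \<open>entry\<close> a run may either leave or pass through a copy of the given
  flowchart and come back to \<open>entry\<close>; the number of rounds is arbitrary.\<close>

lemma realizable_rtrancl:
  assumes "realizable R"
  shows "realizable (R\<^sup>*)"
proof -
  obtain T1 where T1: "flowchart T1" "computes_rel T1 = R"
    using assms by (auto simp: realizable_def)
  define T where "T = {skip entry exit, skip entry (2 # entry), skip (2 # exit) entry} \<union> relabel 2 T1"
  let ?inv = "\<lambda>s l t. (l = entry \<or> l = exit) \<and> (s, t) \<in> R\<^sup>* \<or>
      (\<exists>m s'. l = 2 # m \<and> (s, s') \<in> R\<^sup>* \<and> ((entry, s'), (m, t)) \<in> (move T1)\<^sup>*)"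
  have sound: "((entry, s), (l, t)) \<in> (move T)\<^sup>* \<Longrightarrow> ?inv s l t" for s l t
  proof (induction rule: rtrancl_induct2)
    case (step m t m' t')
    from step.hyps(2) obtain g d where gd: "(m, g, d, m') \<in> T" "g t = 0" "t' = (\<lambda>r. t r + d r)"
      by (rule moveE)
    from gd(1) consider (leave) "m = entry" "m' = exit" "d = (\<lambda>r. 0)"
      | (start) "m = entry" "m' = 2 # entry" "d = (\<lambda>r. 0)"
      | (again) "m = 2 # exit" "m' = entry" "d = (\<lambda>r. 0)"
      | (inner) k k' where "m = 2 # k" "m' = 2 # k'" "(k, g, d, k') \<in> T1"
      by (auto simp: T_def relabel_def)
    then show ?case
    proof cases
      case again
      then show ?thesis using step.IH gd T1(2)
        by (auto simp: computes_rel_def intro: rtrancl_into_rtrancl)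
    next
      case inner
      then have "((k, t), (k', t')) \<in> move T1" using gd by (auto intro: moveI)
      then show ?thesis using step.IH inner by (auto intro: rtrancl_into_rtrancl)
    qed (use step.IH gd in auto)
  qed simp
  have complete: "((entry, s), (entry, t)) \<in> (move T)\<^sup>*" if "(s, t) \<in> R\<^sup>*" for s t
    using that
  proof induction
    case (step t u)
    then have "((entry, t), (exit, u)) \<in> (move T1)\<^sup>*"
      using T1(2) by (auto simp: computes_rel_def)
    then have "((2 # entry, t), (2 # exit, u)) \<in> (move T)\<^sup>*"
      by (auto intro!: rtrancl_move_relabel simp: T_def)
    moreover have "((entry, t), (2 # entry, t)) \<in> move T" "((2 # exit, u), (entry, u)) \<in> move T"
      by (auto intro!: move_skip simp: T_def)
    ultimately show ?case
      using step.IH by (meson rtrancl.rtrancl_into_rtrancl rtrancl_trans)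
  qed simp
  have leave: "((entry, t), (exit, t)) \<in> move T" for t
    by (auto intro!: move_skip simp: T_def)
  have "computes_rel T = R\<^sup>*"
    unfolding computes_rel_def
  proof (intro set_eqI iffI; clarify)
    fix s t assume "((entry, s), (exit, t)) \<in> (move T)\<^sup>*"
    from sound[OF this] show "(s, t) \<in> R\<^sup>*" by auto
  next
    fix s t assume "(s, t) \<in> R\<^sup>*"
    then show "((entry, s), (exit, t)) \<in> (move T)\<^sup>*"
      by (rule rtrancl_into_rtrancl[OF complete leave])
  qed
  moreover have "flowchart T"
    unfolding T_def using T1(1)
    by (intro flowchart_Un flowchart_relabel flowchart_insert flowchart_empty affine.const)
  ultimately show ?thesis by (auto simp: realizable_def)
qed

section \<open>Programs on natural-number registers\<close>

type_synonym state = "nat \<Rightarrow> nat"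

definition embed :: "state \<Rightarrow> nat \<Rightarrow> int" where
  "embed s = (\<lambda>r. int (s r))"

text \<open>\<open>R'\<close> is constrained only at initial states without negative registers,
  where its results must again be of this kind. Registers may become negative in the middle of a
  run, as happens in \<open>definable_havoc\<close>.\<close>

definition definable :: "(state \<times> state) set \<Rightarrow> bool" where
  "definable R \<longleftrightarrow> (\<exists>R'. realizable R' \<and>
     (\<forall>s t. (embed s, t) \<in> R' \<longleftrightarrow> (\<exists>s'. t = embed s' \<and> (s, s') \<in> R)))"

lemma embed_eq_iff [simp]: "embed s = embed t \<longleftrightarrow> s = t"
  by (auto simp: embed_def fun_eq_iff)

lemma definable_assume:
  assumes "affine g"
  shows "definable {(s, t). g (embed s) = 0 \<and> t = s}"
  using realizable_update[OF assms, of "\<lambda>r. 0"] unfolding definable_def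
  by (intro exI[of _ "{(s, t). g s = 0 \<and> t = s}"]) auto

lemma definable_test: "definable {(s, t). s a = s b + c \<and> t = s}"
proof -
  have "definable {(s, t). embed s a - embed s b - int c = 0 \<and> t = s}"
    by (intro definable_assume affine.intros)
  moreover have "embed s a - embed s b - int c = 0 \<longleftrightarrow> s a = s b + c" for s
    by (auto simp: embed_def)
  ultimately show ?thesis by simp
qed

lemma definable_test_const: "definable {(s, t). s a = c \<and> t = s}"
proof -
  have "definable {(s, t). embed s a - int c = 0 \<and> t = s}"
    by (intro definable_assume affine.intros)
  then show ?thesis by (simp add: embed_def)
qed

lemma definable_empty: "definable {}"
  using definable_assume[OF affine.const[of 1]] by simp

lemma definable_Id: "definable Id"
proof -
  have "Id = {(s, t). 0 = (0 :: int) \<and> t = (s :: state)}" by auto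
  then show ?thesis using definable_assume[OF affine.const[of 0]] by simp
qed

lemma definable_relcomp:
  assumes "definable R" "definable S"
  shows "definable (R O S)"
proof -
  obtain R' S' where R': "realizable R'"
      "\<And>s t. (embed s, t) \<in> R' \<longleftrightarrow> (\<exists>s'. t = embed s' \<and> (s, s') \<in> R)"
    and S': "realizable S'"
      "\<And>s t. (embed s, t) \<in> S' \<longleftrightarrow> (\<exists>s'. t = embed s' \<and> (s, s') \<in> S)"
    using assms by (auto simp: definable_def)
  have "(embed s, t) \<in> R' O S' \<longleftrightarrow> (\<exists>s'. t = embed s' \<and> (s, s') \<in> R O S)" for s t
    using R'(2) S'(2) by (auto simp: relcomp.simps) blast+
  then show ?thesis
    using R'(1) S'(1) unfolding definable_def by (blast intro: realizable_relcomp)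
qed

lemma definable_rtrancl:
  assumes "definable R"
  shows "definable (R\<^sup>*)"
proof -
  obtain R' where R': "realizable R'"
    "\<And>s t. (embed s, t) \<in> R' \<longleftrightarrow> (\<exists>s'. t = embed s' \<and> (s, s') \<in> R)"
    using assms by (auto simp: definable_def)
  have "\<exists>s'. t = embed s' \<and> (s, s') \<in> R\<^sup>*" if "(embed s, t) \<in> R'\<^sup>*" for s t
    using that
  proof induction
    case (step t u)
    then show ?case using R'(2) by (auto intro: rtrancl_into_rtrancl)
  qed auto
  moreover have "(embed s, embed s') \<in> R'\<^sup>*" if "(s, s') \<in> R\<^sup>*" for s s'
    using that
  proof induction
    case (step t u)
    then show ?case using R'(2) by (auto intro: rtrancl_into_rtrancl)
  qed auto
  ultimately show ?thesis
    using R'(1) unfolding definable_def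
    by (intro exI[of _ "R'\<^sup>*"]) (auto simp: realizable_rtrancl)
qed

section \<open>Increment, nondeterministic choice and assignment\<close>

lemma realizable_inc: "realizable {(s, t). t = s(r := s r + c)}"
proof -
  have "(\<lambda>q. s q + (if q = r then c else 0)) = s(r := s r + c)" for s :: "nat \<Rightarrow> int"
    by auto
  then show ?thesis
    using realizable_update[OF affine.const[of 0], of "\<lambda>q. if q = r then c else 0"] by simp
qed

lemma embed_upd: "embed (s(r := n)) = (embed s)(r := int n)"
  by (auto simp: embed_def)

lemma definable_inc: "definable {(s, t). t = s(r := Suc (s r))}"
proof -
  have "embed (s(r := Suc (s r))) = (embed s)(r := embed s r + 1)" for s
    by (auto simp: embed_def)
  then show ?thesis
    unfolding definable_def
    by (intro exI[of _ "{(s, t). t = s(r := s r + 1)}"]) (auto simp: realizable_inc)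
qed

lemma rtrancl_inc:
  fixes c :: int
  shows "{(s, t). t = s(r := s r + c)}\<^sup>* = {(s, t). \<exists>n. t = s(r := s r + int n * c)}"
    (is "?R\<^sup>* = ?S")
proof (intro set_eqI iffI; clarify)
  fix s t assume "(s, t) \<in> ?R\<^sup>*"
  then show "\<exists>n. t = s(r := s r + int n * c)"
  proof induction
    case base
    show ?case by (rule exI[of _ 0]) simp
  next
    case (step t u)
    from step.IH obtain n where "t = s(r := s r + int n * c)" ..
    with step.hyps(2) show ?case by (intro exI[of _ "Suc n"]) (simp add: algebra_simps)
  qed
next
  fix s n
  show "(s, s(r := s r + int n * c)) \<in> ?R\<^sup>*"
  proof (induction n)
    case (Suc n)
    have "(s(r := s r + int n * c), s(r := s r + int (Suc n) * c)) \<in> ?R"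
      by (auto simp: algebra_simps)
    then show ?case using Suc by (rule rtrancl_into_rtrancl[rotated])
  qed simp
qed

text \<open>The register is decremented any number of times, tested for 0 and incremented any number
  of times. Runs with the wrong number of decrements get stuck at the test.\<close>

lemma definable_havoc: "definable {(s, t). \<exists>n. t = s(r := n)}"
proof -
  let ?inc = "\<lambda>c. {(s, t :: nat \<Rightarrow> int). t = s(r := s r + c)}\<^sup>*"
  let ?zero = "{(s, t :: nat \<Rightarrow> int). s r = 0 \<and> t = (\<lambda>q. s q + 0)}"
  let ?R = "?inc (- 1) O ?zero O ?inc 1"
  have "realizable ?R"
    by (intro realizable_relcomp realizable_rtrancl realizable_inc realizable_update affine.reg)
  moreover have "(embed s, t) \<in> ?R \<longleftrightarrow> (\<exists>s'. t = embed s' \<and> (\<exists>n. s' = s(r := n)))" for s t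
  proof
    assume "(embed s, t) \<in> ?R"
    then obtain n where "t = (embed s)(r := int n)"
      unfolding rtrancl_inc by (auto simp: fun_upd_upd)
    then show "\<exists>s'. t = embed s' \<and> (\<exists>n. s' = s(r := n))"
      by (intro exI[of _ "s(r := n)"]) (auto simp: embed_upd)
  next
    assume "\<exists>s'. t = embed s' \<and> (\<exists>n. s' = s(r := n))"
    then obtain n where t: "t = embed (s(r := n))" by blast
    have "(embed s, (embed s)(r := 0)) \<in> ?inc (- 1)"
      unfolding rtrancl_inc by (auto intro!: exI[of _ "s r"] simp: embed_def)
    moreover have "((embed s)(r := 0), (embed s)(r := 0)) \<in> ?zero"
      by auto
    moreover have "((embed s)(r := 0), t) \<in> ?inc 1"
      unfolding rtrancl_inc t by (auto intro!: exI[of _ n] simp: embed_upd)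
    ultimately show "(embed s, t) \<in> ?R" by blast
  qed
  ultimately show ?thesis
    unfolding definable_def by (intro exI[of _ ?R]) auto
qed

text \<open>An assignment is a guess of the new value followed by a test.\<close>

lemma definable_assign_const: "definable {(s, t). t = s(r := c)}"
proof -
  have "{(s, t). t = s(r := c)} = {(s, t). \<exists>n. t = s(r := n)} O {(s, t). s r = c \<and> t = s}"
    by (auto simp: relcomp.simps)
  then show ?thesis
    by (simp only: definable_relcomp definable_havoc definable_test_const)
qed

text \<open>Guess and test again; \<open>q \<noteq> r\<close> ensures that the guess does not
  destroy the source register.\<close>

lemma definable_assign:
  assumes "q \<noteq> r"
  shows "definable {(s, t). t = s(r := s q + c)}"
proof -
  have "{(s, t). t = s(r := s q + c)} =
      {(s, t). \<exists>n. t = s(r := n)} O {(s, t). s r = s q + c \<and> t = s}"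
    using assms by (auto simp: relcomp.simps)
  then show ?thesis
    by (simp only: definable_relcomp definable_havoc definable_test)
qed

section \<open>Programs for partial recursive functions\<close>

inductive_cases computes_ZeroE: "computes Zero xs y"
inductive_cases computes_SuccE: "computes Succ xs y"
inductive_cases computes_ProjE: "computes (Proj i) xs y"
inductive_cases computes_CompE: "computes (Comp f gs) xs y"
inductive_cases computes_PrimRecE: "computes (PrimRec f g) xs y"
inductive_cases computes_MuE: "computes (Mu f) xs y"

text \<open>
  The program computes \<open>f\<close> on the registers \<open>xs\<close> into the register \<open>y\<close>; it uses registers from
  \<open>N\<close> on as scratch space, whose contents are arbitrary before and after.
\<close>

definition implements :: "recf \<Rightarrow> nat list \<Rightarrow> nat \<Rightarrow> nat \<Rightarrow> (state \<times> state) set \<Rightarrow> bool" where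
  "implements f xs y N R \<longleftrightarrow> definable R \<and>
     (\<forall>s t. (s, t) \<in> R \<longrightarrow> (\<forall>r<N. r \<noteq> y \<longrightarrow> t r = s r) \<and> computes f (map s xs) (t y)) \<and>
     (\<forall>s b. computes f (map s xs) b \<longrightarrow> (\<exists>t. (s, t) \<in> R \<and> t y = b))"

lemma implementsI:
  assumes "definable R"
    and "\<And>s t r. (s, t) \<in> R \<Longrightarrow> r < N \<Longrightarrow> r \<noteq> y \<Longrightarrow> t r = s r"
    and "\<And>s t. (s, t) \<in> R \<Longrightarrow> computes f (map s xs) (t y)"
    and "\<And>s b. computes f (map s xs) b \<Longrightarrow> \<exists>t. (s, t) \<in> R \<and> t y = b"
  shows "implements f xs y N R"
  using assms by (auto simp: implements_def)

lemma implementsD: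
  assumes "implements f xs y N R"
  shows "definable R"
    and "\<And>s t r. (s, t) \<in> R \<Longrightarrow> r < N \<Longrightarrow> r \<noteq> y \<Longrightarrow> t r = s r"
    and "\<And>s t. (s, t) \<in> R \<Longrightarrow> computes f (map s xs) (t y)"
    and "\<And>s b. computes f (map s xs) b \<Longrightarrow> \<exists>t. (s, t) \<in> R \<and> t y = b"
  using assms by (auto simp: implements_def)

text \<open>All choices of registers are covered, so that induction over \<open>f\<close> can place
  arguments and results freely. The output register is no argument register, hence the arguments
  survive.\<close>

definition implementable :: "recf \<Rightarrow> bool" where
  "implementable f \<longleftrightarrow>
     (\<forall>xs y N. set xs \<subseteq> {..<N} \<longrightarrow> y < N \<longrightarrow> y \<notin> set xs \<longrightarrow> (\<exists>R. implements f xs y N R))"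

lemma implementableE:
  assumes "implementable f" "set xs \<subseteq> {..<N}" "y < N" "y \<notin> set xs"
  obtains R where "implements f xs y N R"
  using assms unfolding implementable_def by blast

section \<open>Induction over the descriptions of partial recursive functions\<close>

lemma implementable_Zero: "implementable Zero"
proof -
  have "implements Zero xs y N {(s, t). t = s(y := 0)}" for xs y N
    by (rule implementsI) (auto intro: definable_assign_const computes.zero elim: computes_ZeroE)
  then show ?thesis by (auto simp: implementable_def)
qed

lemma implementable_Succ: "implementable Succ"
  unfolding implementable_def
proof (intro allI impI)
  fix xs :: "nat list" and y N assume y: "y \<notin> set xs"
  show "\<exists>R. implements Succ xs y N R"
  proof (cases "length xs = 1")
    case True
    then obtain x where x: "xs = [x]" by (auto simp: length_Suc_conv)
    have "implements Succ xs y N {(s, t). t = s(y := s x + 1)}"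
      using y by (intro implementsI definable_assign) (auto simp: x intro: computes.succ elim: computes_SuccE)
    then show ?thesis ..
  next
    case False
    \<comment> \<open>At a tuple of unsuitable length there is no value, so a program without runs
      is correct.\<close>
    have "implements Succ xs y N {}"
      using False by (intro implementsI definable_empty) (auto elim: computes_SuccE)
    then show ?thesis ..
  qed
qed

lemma implementable_Proj: "implementable (Proj i)"
  unfolding implementable_def
proof (intro allI impI)
  fix xs :: "nat list" and y N assume y: "y \<notin> set xs"
  show "\<exists>R. implements (Proj i) xs y N R"
  proof (cases "i < length xs")
    case True
    have "implements (Proj i) xs y N {(s, t). t = s(y := s (xs ! i) + 0)}"
    proof (rule implementsI)
      show "definable {(s, t). t = s(y := s (xs ! i) + 0)}"
        using True y by (intro definable_assign) auto
    qed (use True computes.proj[of i "map _ xs"] in \<open>auto elim!: computes_ProjE\<close>)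
    then show ?thesis ..
  next
    case False
    have "implements (Proj i) xs y N {}"
      using False by (intro implementsI definable_empty) (auto elim: computes_ProjE)
    then show ?thesis ..
  qed
qed

text \<open>The first function writes to register \<open>M\<close>; the others are treated with
  bound \<open>Suc M\<close>, so that they preserve this result together with the arguments.\<close>

lemma implements_list:
  assumes "\<And>g. g \<in> set gs \<Longrightarrow> implementable g" "set xs \<subseteq> {..<M}"
  shows "\<exists>R. definable R \<and>
    (\<forall>s t. (s, t) \<in> R \<longrightarrow> (\<forall>r<M. t r = s r) \<and>
       list_all2 (\<lambda>g y. computes g (map s xs) y) gs (map t [M..<M + length gs])) \<and>
    (\<forall>s bs. list_all2 (\<lambda>g y. computes g (map s xs) y) gs bs \<longrightarrow>
       (\<exists>t. (s, t) \<in> R \<and> map t [M..<M + length gs] = bs))"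
  using assms
proof (induction gs arbitrary: M)
  case Nil
  show ?case by (rule exI[of _ Id]) (simp add: definable_Id)
next
  case (Cons g gs)
  have "implementable g" "set xs \<subseteq> {..<Suc M}" "M \<notin> set xs"
    using Cons.prems by (auto simp: subset_iff)
  then obtain R1 where "implements g xs M (Suc M) R1"
    by (metis implementableE lessI)
  note R1 = implementsD[OF this]
  obtain R2 where R2: "definable R2"
    "\<And>s t r. (s, t) \<in> R2 \<Longrightarrow> r < Suc M \<Longrightarrow> t r = s r"
    "\<And>s t. (s, t) \<in> R2 \<Longrightarrow>
       list_all2 (\<lambda>g y. computes g (map s xs) y) gs (map t [Suc M..<Suc M + length gs])"
    "\<And>s bs. list_all2 (\<lambda>g y. computes g (map s xs) y) gs bs \<Longrightarrow>
       \<exists>t. (s, t) \<in> R2 \<and> map t [Suc M..<Suc M + length gs] = bs"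
    using Cons.IH[of "Suc M"] Cons.prems by fastforce
  have upt: "[M..<M + length (g # gs)] = M # [Suc M..<Suc M + length gs]"
    by (simp add: upt_rec)
  have same: "map t xs = map s xs" if "(s, t) \<in> R1" for s t
    using that R1(2)[OF that] Cons.prems(2) by fastforce
  show ?case
  proof (intro exI[of _ "R1 O R2"] conjI allI impI)
    show "definable (R1 O R2)" using R1(1) R2(1) by (rule definable_relcomp)
  next
    fix s t r assume "(s, t) \<in> R1 O R2" "r < M"
    then show "t r = s r" using R1(2) R2(2) by fastforce
  next
    fix s t assume "(s, t) \<in> R1 O R2"
    then obtain u where u: "(s, u) \<in> R1" "(u, t) \<in> R2" by blast
    have "t M = u M" using R2(2)[OF u(2)] by simp
    then show "list_all2 (\<lambda>g y. computes g (map s xs) y) (g # gs) (map t [M..<M + length (g # gs)])"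
      unfolding upt using R1(3)[OF u(1)] R2(3)[OF u(2)] same[OF u(1)] by simp
  next
    fix s bs assume "list_all2 (\<lambda>g y. computes g (map s xs) y) (g # gs) bs"
    then obtain b bs' where bs: "bs = b # bs'" "computes g (map s xs) b"
      "list_all2 (\<lambda>g y. computes g (map s xs) y) gs bs'"
      by (auto simp: list_all2_Cons1)
    obtain u where u: "(s, u) \<in> R1" "u M = b" using R1(4)[OF bs(2)] by blast
    obtain t where t: "(u, t) \<in> R2" "map t [Suc M..<Suc M + length gs] = bs'"
      using R2(4)[of u bs'] bs(3) same[OF u(1)] by auto
    have "t M = b" using R2(2)[OF t(1)] u(2) by simp
    then show "\<exists>t. (s, t) \<in> R1 O R2 \<and> map t [M..<M + length (g # gs)] = bs"
      unfolding upt using u(1) t bs(1) by (intro exI[of _ t]) auto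
  qed
qed

text \<open>The intermediate values are stored from register \<open>N\<close> on, and
  \<open>f\<close> gets its scratch space behind them.\<close>

lemma implementable_Comp:
  assumes f: "implementable f" and gs: "\<And>g. g \<in> set gs \<Longrightarrow> implementable g"
  shows "implementable (Comp f gs)"
  unfolding implementable_def
proof (intro allI impI)
  fix xs :: "nat list" and y N
  assume xs: "set xs \<subseteq> {..<N}" and y: "y < N" "y \<notin> set xs"
  let ?zs = "[N..<N + length gs]"
  obtain R1 where "definable R1 \<and>
      (\<forall>s t. (s, t) \<in> R1 \<longrightarrow> (\<forall>r<N. t r = s r) \<and>
         list_all2 (\<lambda>g y. computes g (map s xs) y) gs (map t ?zs)) \<and>
      (\<forall>s bs. list_all2 (\<lambda>g y. computes g (map s xs) y) gs bs \<longrightarrow>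
         (\<exists>t. (s, t) \<in> R1 \<and> map t ?zs = bs))"
    using implements_list[OF gs xs] by (rule exE)
  then have R1: "definable R1"
    "\<And>s t r. (s, t) \<in> R1 \<Longrightarrow> r < N \<Longrightarrow> t r = s r"
    "\<And>s t. (s, t) \<in> R1 \<Longrightarrow> list_all2 (\<lambda>g y. computes g (map s xs) y) gs (map t ?zs)"
    "\<And>s bs. list_all2 (\<lambda>g y. computes g (map s xs) y) gs bs \<Longrightarrow>
       \<exists>t. (s, t) \<in> R1 \<and> map t ?zs = bs"
    by blast+
  have "set ?zs \<subseteq> {..<N + length gs}" "y \<notin> set ?zs" "y < N + length gs"
    using y by auto
  then obtain R2 where "implements f ?zs y (N + length gs) R2"
    using f by (metis implementableE)
  note R2 = implementsD[OF this]
  have "implements (Comp f gs) xs y N (R1 O R2)"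
  proof (rule implementsI)
    show "definable (R1 O R2)" using R1(1) R2(1) by (rule definable_relcomp)
  next
    fix s t r assume "(s, t) \<in> R1 O R2" "r < N" "r \<noteq> y"
    then show "t r = s r" using R1(2) R2(2) by fastforce
  next
    fix s t assume "(s, t) \<in> R1 O R2"
    then obtain u where u: "(s, u) \<in> R1" "(u, t) \<in> R2" by blast
    show "computes (Comp f gs) (map s xs) (t y)"
      by (rule computes.comp[OF R1(3)[OF u(1)] R2(3)[OF u(2)]])
  next
    fix s b assume "computes (Comp f gs) (map s xs) b"
    then obtain bs where bs: "list_all2 (\<lambda>g y. computes g (map s xs) y) gs bs" "computes f bs b"
      by (auto elim: computes_CompE)
    obtain u where u: "(s, u) \<in> R1" "map u ?zs = bs" using R1(4)[OF bs(1)] by blast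
    obtain t where "(u, t) \<in> R2" "t y = b" using R2(4)[of u b] bs(2) u(2) by auto
    then show "\<exists>t. (s, t) \<in> R1 O R2 \<and> t y = b" using u(1) by blast
  qed
  then show "\<exists>R. implements (Comp f gs) xs y N R" ..
qed

text \<open>Register \<open>i\<close> counts the rounds, \<open>a\<close> holds the value reached so
  far and \<open>b\<close> receives the next one. The number of rounds is guessed and compared with
  the argument \<open>x\<close> after the loop.\<close>

lemma implementable_PrimRec:
  assumes f: "implementable f" and g: "implementable g"
  shows "implementable (PrimRec f g)"
  unfolding implementable_def
proof (intro allI impI)
  fix xs :: "nat list" and y N
  assume xs: "set xs \<subseteq> {..<N}" and y: "y < N" "y \<notin> set xs"
  show "\<exists>R. implements (PrimRec f g) xs y N R"
  proof (cases xs)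
    case Nil
    then have "implements (PrimRec f g) xs y N {}"
      by (intro implementsI definable_empty) (auto elim: computes_PrimRecE)
    then show ?thesis ..
  next
    case (Cons x zs)
    define i where "i = N"
    define a where "a = Suc N"
    define b where "b = Suc (Suc N)"
    define M where "M = Suc (Suc (Suc N))"
    have regs [simp]: "i \<noteq> a" "a \<noteq> i" "i \<noteq> b" "b \<noteq> i" "a \<noteq> b" "b \<noteq> a" "i < M" "a < M" "b < M"
      "\<not> i < N" "\<not> a < N" "\<not> b < N" "y \<noteq> i" "y \<noteq> a" "y \<noteq> b" "i \<noteq> y" "a \<noteq> y" "b \<noteq> y"
      using y by (auto simp: i_def a_def b_def M_def)
    have less_M: "r < M \<and> r \<noteq> i \<and> r \<noteq> a \<and> r \<noteq> b" if "r < N" for r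
    using that by (auto simp: i_def a_def b_def M_def)
    have x: "x < N" and zs: "set zs \<subseteq> {..<N}" using xs by (auto simp: Cons)
    have "set zs \<subseteq> {..<M}" "set (i # a # zs) \<subseteq> {..<M}" "a \<notin> set zs" "b \<notin> set (i # a # zs)"
      using zs by (auto dest: less_M)
    then obtain F G where "implements f zs a M F" "implements g (i # a # zs) b M G"
      using f g by (metis implementableE regs(7-9))
    note F = implementsD[OF this(1)] and G = implementsD[OF this(2)]
    define body where "body = G O {(s, t). t = s(a := s b + 0)} O {(s, t). t = s(i := Suc (s i))}"
    define R where "R = {(s, t). t = s(i := 0)} O F O body\<^sup>* O {(s, t). s x = s i + 0 \<and> t = s} O
      {(s, t). t = s(y := s a + 0)}"
    have def: "definable R"
      unfolding R_def body_def using F(1) G(1) y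
      by (intro definable_relcomp definable_rtrancl definable_inc definable_test
          definable_assign definable_assign_const) auto
    have body_sound: "(\<forall>r<N. t r = s r) \<and> t i = Suc (s i) \<and>
        computes g (s i # s a # map s zs) (t a)" if "(s, t) \<in> body" for s t
    proof -
      from that obtain u where u: "(s, u) \<in> G" "t = u(a := u b, i := Suc (u i))"
        by (auto simp: body_def)
      show ?thesis using G(2,3)[OF u(1)] u(2) by (auto dest: less_M)
    qed
    have body_complete: "\<exists>t. (s, t) \<in> body \<and> t a = c"
      if c: "computes g (s i # s a # map s zs) c" for s c
    proof -
      obtain u where "(s, u) \<in> G" "u b = c" using G(4)[of s c] c by auto
      then have "(s, u(a := u b, i := Suc (u i))) \<in> body" unfolding body_def
        by (intro relcompI[of s u]) (auto simp: relcomp.simps)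
      then show ?thesis using \<open>u b = c\<close>
        by (intro exI[of _ "u(a := u b, i := Suc (u i))"]) simp
    qed
    \<comment> \<open>Loop invariant: \<open>a\<close> holds the value of the recursion at the
      number in \<open>i\<close>.\<close>
    have loop_sound: "(\<forall>r<N. t r = s r) \<and> computes (PrimRec f g) (t i # map s zs) (t a)"
      if "(u, t) \<in> body\<^sup>*" and u: "\<forall>r<N. u r = s r" "u i = 0" "computes f (map s zs) (u a)" for s u t
      using that(1)
    proof induction
      case base
      show ?case using u by (simp add: computes.primrec_0)
    next
      case (step t v)
      have "map t zs = map s zs" using step.IH zs by auto
      then have "computes (PrimRec f g) (Suc (t i) # map s zs) (v a)"
        using body_sound[OF step.hyps(2)] step.IH by (metis computes.primrec_Suc)
      then show ?case
        using body_sound[OF step.hyps(2)] step.IH by simp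
    qed
    have loop_complete: "\<exists>t. (u, t) \<in> body\<^sup>* \<and> t i = n \<and> t a = c"
      if "computes (PrimRec f g) (n # map s zs) c"
        and u: "\<forall>r<N. u r = s r" "u i = 0" "computes f (map s zs) (u a)" for s u n c
      using that(1)
    proof (induction n arbitrary: c)
      case 0
      then have "computes f (map s zs) c" by (auto elim: computes_PrimRecE)
      then have "u a = c" using u(3) computes_functional by blast
      then show ?case using u(2) by (intro exI[of _ u]) simp
    next
      case (Suc n)
      then obtain d where d: "computes (PrimRec f g) (n # map s zs) d"
        "computes g (n # d # map s zs) c"
        by (auto elim: computes_PrimRecE)
      obtain t where t: "(u, t) \<in> body\<^sup>*" "t i = n" "t a = d" using Suc.IH[OF d(1)] by blast
      have "map t zs = map s zs" using loop_sound[OF t(1) u] zs by auto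
      then obtain v where v: "(t, v) \<in> body" "v a = c"
        using body_complete[of t c] d(2) t(2,3) by (auto simp del: map_eq_conv)
      have "(u, v) \<in> body\<^sup>*" using t(1) v(1) by (rule rtrancl_into_rtrancl)
      moreover have "v i = Suc n" using body_sound[OF v(1)] t(2) by simp
      ultimately show ?case using v(2) by blast
    qed
    have init: "(\<forall>r<N. u r = s r) \<and> u i = 0 \<and> computes f (map s zs) (u a)"
      if "(s(i := 0), u) \<in> F" for s u
    proof -
      have "map (s(i := 0)) zs = map s zs" using zs by auto
      then show ?thesis
        using F(2,3)[OF that] by (auto dest: less_M simp del: map_eq_conv)
    qed
    have "implements (PrimRec f g) xs y N R"
    proof (rule implementsI[OF def])
      fix s t r assume "(s, t) \<in> R" "r < N" "r \<noteq> y"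
      then obtain u v where u: "(s(i := 0), u) \<in> F" and v: "(u, v) \<in> body\<^sup>*" "t = v(y := v a)"
        by (auto simp: R_def)
      show "t r = s r"
        using loop_sound[OF v(1)] init[OF u] v(2) \<open>r < N\<close> \<open>r \<noteq> y\<close> by auto
    next
      fix s t assume "(s, t) \<in> R"
      then obtain u v where u: "(s(i := 0), u) \<in> F" and v: "(u, v) \<in> body\<^sup>*" "v x = v i"
          "t = v(y := v a)"
        by (auto simp: R_def)
      show "computes (PrimRec f g) (map s xs) (t y)"
        using loop_sound[OF v(1), of s] init[OF u] v(2,3) x by (auto simp: Cons)
    next
      fix s c assume c: "computes (PrimRec f g) (map s xs) c"
      \<comment> \<open>A value at any stage requires values at all earlier stages, down to a value
        of \<open>f\<close>.\<close>
      then have "\<exists>d. computes f (map s zs) d"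
      proof -
        have "computes (PrimRec f g) (n # map s zs) c \<Longrightarrow> \<exists>d. computes f (map s zs) d" for n c
          by (induction n arbitrary: c) (auto elim: computes_PrimRecE)
        then show ?thesis using c by (simp add: Cons)
      qed
      then obtain d where "computes f (map s zs) d" ..
      moreover have "map (s(i := 0)) zs = map s zs" using zs by auto
      ultimately obtain u where u: "(s(i := 0), u) \<in> F" using F(4)[of "s(i := 0)" d] by (auto simp del: map_eq_conv)
      obtain v where v: "(u, v) \<in> body\<^sup>*" "v i = s x" "v a = c"
        using loop_complete[of "s x" s c u] c init[OF u] by (auto simp: Cons)
      have "v x = s x" using loop_sound[OF v(1), of s] init[OF u] x by auto
      then have "(s, v(y := v a)) \<in> R"
        unfolding R_def by (intro relcompI[OF _ relcompI[OF u relcompI[OF v(1)]]])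
          (auto simp: relcomp.simps v(2))
      then show "\<exists>t. (s, t) \<in> R \<and> t y = c"
        using v(3) by (intro exI[of _ "v(y := v a)"]) simp
    qed
    then show ?thesis ..
  qed
qed

text \<open>The candidate \<open>i\<close> is raised only after a nonzero value of \<open>f\<close>
  has been confirmed. The number of rounds is guessed, and the value at the final candidate is
  tested for 0.\<close>

lemma implementable_Mu:
  assumes f: "implementable f"
  shows "implementable (Mu f)"
  unfolding implementable_def
proof (intro allI impI)
  fix xs :: "nat list" and y N
  assume xs: "set xs \<subseteq> {..<N}" and y: "y < N" "y \<notin> set xs"
  define i where "i = N"
  define a where "a = Suc N"
  define b where "b = Suc (Suc N)"
  define M where "M = Suc (Suc (Suc N))"
  have regs [simp]: "i \<noteq> a" "a \<noteq> i" "i \<noteq> b" "b \<noteq> i" "a \<noteq> b" "b \<noteq> a" "i < M" "a < M" "b < M"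
    "\<not> i < N" "\<not> a < N" "\<not> b < N" "y \<noteq> i" "y \<noteq> a" "y \<noteq> b" "i \<noteq> y" "a \<noteq> y" "b \<noteq> y"
    using y by (auto simp: i_def a_def b_def M_def)
  have less_M: "r < M \<and> r \<noteq> i \<and> r \<noteq> a \<and> r \<noteq> b" if "r < N" for r
    using that by (auto simp: i_def a_def b_def M_def)
  have "set (i # xs) \<subseteq> {..<M}" "a \<notin> set (i # xs)"
    using xs by (auto dest: less_M)
  then obtain F where "implements f (i # xs) a M F"
    using f by (metis implementableE a_def M_def lessI less_SucI)
  note F = implementsD[OF this]
  \<comment> \<open>Guards are equations only, so positivity of \<open>a\<close> is tested by
    guessing its predecessor in \<open>b\<close>.\<close>
  define body where "body = F O {(s, t). \<exists>n. t = s(b := n)} O {(s, t). s a = s b + 1 \<and> t = s} O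
    {(s, t). t = s(i := Suc (s i))}"
  define R where "R = {(s, t). t = s(i := 0)} O body\<^sup>* O F O {(s, t). s a = 0 \<and> t = s} O
    {(s, t). t = s(y := s i + 0)}"
  have def: "definable R"
    unfolding R_def body_def using F(1) y
    by (intro definable_relcomp definable_rtrancl definable_inc definable_test definable_havoc
        definable_test_const definable_assign definable_assign_const) auto
  have body_sound: "(\<forall>r<N. t r = s r) \<and> t i = Suc (s i) \<and> (\<exists>c>0. computes f (s i # map s xs) c)"
    if "(s, t) \<in> body" for s t
  proof -
    from that obtain u n where u: "(s, u) \<in> F" "u a = n + 1" "t = u(b := n, i := Suc (u i))"
      by (auto simp: body_def)
    have "computes f (s i # map s xs) (u a)" using F(3)[OF u(1)] by simp
    then show ?thesis using F(2)[OF u(1)] u(2,3) by (auto dest: less_M)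
  qed
  have body_complete: "\<exists>t. (s, t) \<in> body" if c: "computes f (s i # map s xs) c" "c > 0" for s c
  proof -
    obtain u where u: "(s, u) \<in> F" "u a = c" using F(4)[of s c] c by auto
    then have "(s, u(b := c - 1, i := Suc (u i))) \<in> body"
      unfolding body_def using c(2)
      by (intro relcompI[of s u]) (auto simp: relcomp.simps intro!: exI[of _ "c - 1"])
    then show ?thesis by blast
  qed
  have loop_sound: "(\<forall>r<N. t r = s r) \<and> (\<forall>m<t i. \<exists>c>0. computes f (m # map s xs) c)"
    if "(s(i := 0), t) \<in> body\<^sup>*" for s t
    using that
  proof induction
    case base
    show ?case by simp
  next
    case (step t v)
    have "map t xs = map s xs" using step.IH xs by auto
    then show ?case
      using body_sound[OF step.hyps(2)] step.IH by (auto simp: less_Suc_eq simp del: map_eq_conv)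
  qed
  have loop_complete: "\<exists>t. (s(i := 0), t) \<in> body\<^sup>* \<and> t i = n"
    if "\<forall>m<n. \<exists>c>0. computes f (m # map s xs) c" for s n
    using that
  proof (induction n)
    case 0
    show ?case by (intro exI[of _ "s(i := 0)"]) simp
  next
    case (Suc n)
    then obtain t where t: "(s(i := 0), t) \<in> body\<^sup>*" "t i = n" using less_SucI by blast
    have "map t xs = map s xs" using loop_sound[OF t(1)] xs by auto
    then obtain v where v: "(t, v) \<in> body"
      using body_complete[of t] Suc.prems t(2) by (metis lessI)
    have "(s(i := 0), v) \<in> body\<^sup>*" using t(1) v by (rule rtrancl_into_rtrancl)
    moreover have "v i = Suc n" using body_sound[OF v] t(2) by simp
    ultimately show ?case by blast
  qed
  have R_cases: "\<exists>u v. (s(i := 0), u) \<in> body\<^sup>* \<and> (u, v) \<in> F \<and> v a = 0 \<and> t = v(y := v i)"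
    if "(s, t) \<in> R" for s t
    using that by (auto simp: R_def)
  have "implements (Mu f) xs y N R"
  proof (rule implementsI[OF def])
    fix s t r assume "(s, t) \<in> R" "r < N" "r \<noteq> y"
    then obtain u v where u: "(s(i := 0), u) \<in> body\<^sup>*" and v: "(u, v) \<in> F" "t = v(y := v i)"
      using R_cases by blast
    show "t r = s r"
      using loop_sound[OF u] F(2)[OF v(1), of r] v(2) \<open>r < N\<close> \<open>r \<noteq> y\<close> by (auto dest: less_M)
  next
    fix s t assume "(s, t) \<in> R"
    then obtain u v where u: "(s(i := 0), u) \<in> body\<^sup>*" and v: "(u, v) \<in> F" "v a = 0"
        "t = v(y := v i)"
      using R_cases by blast
    have "v i = u i" using F(2)[OF v(1), of i] by simp
    moreover have "map u xs = map s xs" using loop_sound[OF u] xs by auto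
    ultimately have "computes f (v i # map s xs) 0"
      using F(3)[OF v(1)] v(2) by (simp del: map_eq_conv)
    then show "computes (Mu f) (map s xs) (t y)"
      using loop_sound[OF u] \<open>v i = u i\<close> v(3) by (auto intro: computes.mu)
  next
    fix s c assume "computes (Mu f) (map s xs) c"
    then have c: "computes f (c # map s xs) 0" "\<forall>m<c. \<exists>y>0. computes f (m # map s xs) y"
      by (auto elim: computes_MuE)
    obtain u where u: "(s(i := 0), u) \<in> body\<^sup>*" "u i = c"
      using loop_complete[OF c(2)] by blast
    have "map u xs = map s xs" using loop_sound[OF u(1)] xs by auto
    then obtain v where v: "(u, v) \<in> F" "v a = 0" using F(4)[of u 0] c(1) u(2) by (auto simp del: map_eq_conv)
    have "v i = c" using F(2)[OF v(1), of i] u(2) by simp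
    moreover have "(s, v(y := v i)) \<in> R"
      unfolding R_def by (intro relcompI[OF _ relcompI[OF u(1) relcompI[OF v(1)]]])
        (auto simp: relcomp.simps v(2))
    ultimately show "\<exists>t. (s, t) \<in> R \<and> t y = c"
      by (intro exI[of _ "v(y := v i)"]) simp
  qed
  then show "\<exists>R. implements (Mu f) xs y N R" ..
qed

lemma implementable: "implementable f"
  by (induction f)
    (simp_all add: implementable_Zero implementable_Succ implementable_Proj implementable_Comp
      implementable_PrimRec implementable_Mu)

section \<open>Words as traces of flowcharts\<close>

text \<open>
  A word is read from right to left. The letter \<open>k + 2\<close> stands for the \<open>k\<close>-th transition of the
  flowchart; the letters 0 and 1 do nothing and carry the two inputs by their multiplicities.
  The current label is represented by its code number \<open>label_code\<close>.
\<close>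

definition source :: "transition \<Rightarrow> nat list" where "source = (\<lambda>(l, g, d, l'). l)"
definition target :: "transition \<Rightarrow> nat list" where "target = (\<lambda>(l, g, d, l'). l')"
definition guard :: "transition \<Rightarrow> (nat \<Rightarrow> int) \<Rightarrow> int" where "guard = (\<lambda>(l, g, d, l'). g)"
definition effect :: "transition \<Rightarrow> nat \<Rightarrow> int" where "effect = (\<lambda>(l, g, d, l'). d)"

lemma transition_simps [simp]:
  "source (l, g, d, l') = l" "target (l, g, d, l') = l'"
  "guard (l, g, d, l') = g" "effect (l, g, d, l') = d"
  by (simp_all add: source_def target_def guard_def effect_def)

abbreviation label_code :: "nat list \<Rightarrow> int" where
  "label_code l \<equiv> int (list_encode l)"

definition transition_letters :: "transition list \<Rightarrow> nat set" where
  "transition_letters ts = {2..<length ts + 2}"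

fun regs :: "transition list \<Rightarrow> nat list \<Rightarrow> nat \<Rightarrow> int" where
  "regs ts [] r = 0"
| "regs ts (x # w) r =
     regs ts w r + (if x \<in> transition_letters ts then effect (ts ! (x - 2)) r else 0)"

text \<open>Every transition adds the difference of its two label codes, an increment that depends
  on the letter alone. The value is the code of the current label as long as the transitions fit
  together.\<close>

fun label :: "transition list \<Rightarrow> nat list \<Rightarrow> int" where
  "label ts [] = label_code entry"
| "label ts (x # w) = label ts w + (if x \<in> transition_letters ts
     then label_code (target (ts ! (x - 2))) - label_code (source (ts ! (x - 2))) else 0)"

text \<open>The word is read from right to left, so \<open>w\<close> is the past of the letter
  \<open>x\<close>. Violations contribute squares and cannot cancel: the sum is 0 iff every
  transition starts at the current label with vanishing guard.\<close>

fun errors :: "transition list \<Rightarrow> nat list \<Rightarrow> int" where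
  "errors ts [] = 0"
| "errors ts (x # w) = errors ts w + (if x \<in> transition_letters ts
     then (label ts w - label_code (source (ts ! (x - 2))))\<^sup>2 + (guard (ts ! (x - 2)) (regs ts w))\<^sup>2
     else 0)"

lemma errors_nonneg: "0 \<le> errors ts w"
  by (induction w) auto

definition alphabet :: "transition list \<Rightarrow> nat set" where
  "alphabet ts = {..<length ts + 2}"

lemma finite_alphabet: "finite (alphabet ts)"
  by (simp add: alphabet_def)

lemma transition_letters_alphabet: "x \<in> transition_letters ts \<Longrightarrow> x \<in> alphabet ts"
  by (simp add: alphabet_def transition_letters_def)

section \<open>Registers, label and errors as subword functions\<close>

lemma subword_fun_transitions:
  assumes "\<And>x. x \<in> transition_letters ts \<Longrightarrow> subword_fun (alphabet ts) (h x)"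
    and "\<And>x w. f (x # w) = f w + (if x \<in> transition_letters ts then h x w else 0)"
  shows "subword_fun (alphabet ts) f"
proof (rule subword_fun_accumulate[OF finite_alphabet])
  fix x show "subword_fun (alphabet ts) (\<lambda>w. if x \<in> transition_letters ts then h x w else 0)"
    by (intro subword_fun_if assms(1))
next
  fix x w
  show "f (x # w) = f w + (if x \<in> alphabet ts
      then if x \<in> transition_letters ts then h x w else 0 else 0)"
    using assms(2) transition_letters_alphabet by auto
qed

lemma subword_fun_regs: "subword_fun (alphabet ts) (\<lambda>w. regs ts w r)"
  by (rule subword_fun_transitions[OF subword_fun_const]) simp

lemma subword_fun_label: "subword_fun (alphabet ts) (label ts)"
  by (rule subword_fun_transitions[OF subword_fun_const]) simp

lemma subword_fun_affine:
  "affine g \<Longrightarrow> subword_fun (alphabet ts) (\<lambda>w. g (regs ts w))"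
  by (induction rule: affine.induct)
    (auto intro: subword_fun_const subword_fun_regs subword_fun_diff)

lemma subword_fun_errors:
  assumes "flowchart (set ts)"
  shows "subword_fun (alphabet ts) (errors ts)"
proof (rule subword_fun_transitions)
  fix x assume "x \<in> transition_letters ts"
  then have "ts ! (x - 2) \<in> set ts" by (auto simp: transition_letters_def)
  then have "affine (guard (ts ! (x - 2)))"
    using assms by (fastforce simp: flowchart_def guard_def)
  then show "subword_fun (alphabet ts)
      (\<lambda>w. (label ts w - label_code (source (ts ! (x - 2))))\<^sup>2 + (guard (ts ! (x - 2)) (regs ts w))\<^sup>2)"
    by (intro subword_fun.add subword_fun_power2 finite_alphabet subword_fun_diff
        subword_fun_label subword_fun_const subword_fun_affine)
qed simp

section \<open>Words without errors and runs of the flowchart\<close>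

text \<open>Induction over the word: errors of a suffix vanish too, as all summands are nonnegative,
  and the two squares of a new transition letter say precisely that it is a legal move.\<close>

lemma label_reachable:
  assumes "errors ts w = 0"
  shows "\<exists>l. label ts w = label_code l \<and>
    ((entry, \<lambda>r. 0), (l, regs ts w)) \<in> (move (set ts))\<^sup>*"
  using assms
proof (induction w)
  case Nil
  have "regs ts [] = (\<lambda>r. 0)" by auto
  then show ?case by (intro exI[of _ entry]) (simp del: list_encode.simps)
next
  case (Cons x w)
  have "errors ts w = 0"
    using Cons.prems errors_nonneg[of ts w] by (auto split: if_splits)
      (smt (verit) zero_le_power2)
  then obtain l where l: "label ts w = label_code l"
    "((entry, \<lambda>r. 0), (l, regs ts w)) \<in> (move (set ts))\<^sup>*"
    using Cons.IH by blast
  show ?case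
  proof (cases "x \<in> transition_letters ts")
    case False
    then have "regs ts (x # w) = regs ts w" by auto
    then show ?thesis using l False by auto
  next
    case True
    obtain k g d k' where t: "ts ! (x - 2) = (k, g, d, k')" by (metis prod_cases4)
    have "(k, g, d, k') \<in> set ts"
      using True t by (metis add.commute diff_less_mono transition_letters_def
          atLeastLessThan_iff add_diff_cancel_left' nth_mem)
    moreover have "(label ts w - label_code k)\<^sup>2 + (g (regs ts w))\<^sup>2 = 0"
      using Cons.prems True \<open>errors ts w = 0\<close> by (simp add: t)
    then have "label_code l = label_code k" "g (regs ts w) = 0"
      by (simp_all add: l(1) sum_power2_eq_zero_iff)
    moreover have "l = k" using \<open>label_code l = label_code k\<close> by (simp add: list_encode_eq)
    moreover have "regs ts (x # w) = (\<lambda>r. regs ts w r + d r)" using True t by auto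
    ultimately have "((l, regs ts w), (k', regs ts (x # w))) \<in> move (set ts)"
      by (auto intro: moveI)
    moreover have "label ts (x # w) = label_code k'"
      using True t l(1) \<open>l = k\<close> by simp
    ultimately show ?thesis using l(2) by (meson rtrancl.rtrancl_into_rtrancl)
  qed
qed

text \<open>Each move of the run prepends the letter of its transition. No idle letters occur, so
  their multiplicities can be chosen afterwards.\<close>

lemma trace_exists:
  assumes "((entry, \<lambda>r. 0), (l, s)) \<in> (move (set ts))\<^sup>*"
  shows "\<exists>w\<in>lists (transition_letters ts). errors ts w = 0 \<and> label ts w = label_code l \<and> regs ts w = s"
  using assms
proof (induction rule: rtrancl_induct2)
  case refl
  have "regs ts [] = (\<lambda>r. 0)" by auto
  then show ?case by (intro bexI[of _ "[]"]) auto
next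
  case (step l s l' s')
  then obtain w where w: "w \<in> lists (transition_letters ts)" "errors ts w = 0"
    "label ts w = label_code l" "regs ts w = s"
    by blast
  obtain g d where t: "(l, g, d, l') \<in> set ts" "g s = 0" "s' = (\<lambda>r. s r + d r)"
    using step.hyps(2) by (rule moveE)
  from t(1) obtain i where i: "i < length ts" "ts ! i = (l, g, d, l')"
    by (auto simp: in_set_conv_nth)
  have x: "i + 2 \<in> transition_letters ts" using i(1) by (simp add: transition_letters_def)
  show ?case
  proof (intro bexI conjI)
    show "regs ts ((i + 2) # w) = s'" using x i(2) w(4) t(3) by auto
    show "errors ts ((i + 2) # w) = 0" "label ts ((i + 2) # w) = label_code l'"
      using x w i(2) t(2) by simp_all
    show "(i + 2) # w \<in> lists (transition_letters ts)"
      using x w(1) by simp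
  qed
qed

lemma idle_prefix:
  assumes "\<forall>x\<in>set v. x \<notin> transition_letters ts"
  shows "errors ts (v @ w) = errors ts w" "label ts (v @ w) = label ts w"
    "regs ts (v @ w) r = regs ts w r"
  using assms by (induction v) auto

section \<open>Histories for flowcharts and for partial recursive functions\<close>

text \<open>Because of the lower bound - 1, adding a positive integer to the value makes it
  nonnegative. Hence extra conditions can later be imposed by adding squares.\<close>

definition represents :: "nat set \<Rightarrow> nat subword_history \<Rightarrow> (nat \<Rightarrow> nat \<Rightarrow> bool) \<Rightarrow> bool" where
  "represents \<Sigma> s P \<longleftrightarrow> finite \<Sigma> \<and> 0 \<in> \<Sigma> \<and> 1 \<in> \<Sigma> \<and> letters s \<subseteq> \<Sigma> \<and>
     (\<forall>w. - 1 \<le> sh_value w s) \<and>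
     (\<forall>m n. (\<exists>w\<in>lists \<Sigma>. sh_value w s < 0 \<and> count_list w 0 = m \<and> count_list w 1 = n) \<longleftrightarrow> P m n)"

lemma flowchart_history:
  assumes "flowchart T"
  shows "\<exists>\<Sigma> s. represents \<Sigma> s
    (\<lambda>m n. \<exists>t. ((\<lambda>r. 0), t) \<in> computes_rel T \<and> t 0 = int m \<and> t 1 = int n)"
proof -
  obtain ts where ts: "set ts = T"
    using assms finite_list by (auto simp: flowchart_def)
  let ?A = "alphabet ts"
  \<comment> \<open>All summands before the final - 1 are nonnegative integers, so
    \<open>F w\<close> is negative iff they all vanish: \<open>w\<close> traces a run to
    \<open>exit\<close> whose final registers 0 and 1 agree with the letter counts.\<close>
  define F where "F w = errors ts w + (label ts w - label_code exit)\<^sup>2 +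
    (int (count_list w 0) - regs ts w 0)\<^sup>2 + (int (count_list w 1) - regs ts w 1)\<^sup>2 - 1" for w
  have A: "0 \<in> ?A" "1 \<in> ?A" by (auto simp: alphabet_def)
  have "subword_fun ?A F"
    unfolding F_def using assms ts A
    by (intro subword_fun.add subword_fun_power2 finite_alphabet subword_fun_diff subword_fun_errors
        subword_fun_label subword_fun_const subword_fun_letter subword_fun_regs) auto
  then obtain s where s: "letters s \<subseteq> ?A" "\<And>w. sh_value w s = F w"
    using subword_fun_history by blast
  have F_neg: "F w < 0 \<longleftrightarrow> errors ts w = 0 \<and> label ts w = label_code exit \<and>
      int (count_list w 0) = regs ts w 0 \<and> int (count_list w 1) = regs ts w 1" for w
  proof -
    have sum0: "a + b\<^sup>2 + c\<^sup>2 + d\<^sup>2 - 1 < 0 \<longleftrightarrow> a = 0 \<and> b = 0 \<and> c = 0 \<and> d = 0"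
      if "0 \<le> a" for a b c d :: int
    proof
      assume "a + b\<^sup>2 + c\<^sup>2 + d\<^sup>2 - 1 < 0"
      then have "a = 0 \<and> b\<^sup>2 = 0 \<and> c\<^sup>2 = 0 \<and> d\<^sup>2 = 0"
        using that zero_le_power2[of b] zero_le_power2[of c] zero_le_power2[of d] by linarith
      then show "a = 0 \<and> b = 0 \<and> c = 0 \<and> d = 0" by simp
    qed simp
    show ?thesis unfolding F_def by (subst sum0[OF errors_nonneg]) auto
  qed
  have F_ge: "- 1 \<le> sh_value w s" for w
    using errors_nonneg[of ts w] unfolding s(2) F_def
    by (smt (verit) zero_le_power2)
  have iff: "(\<exists>w\<in>lists ?A. sh_value w s < 0 \<and> count_list w 0 = m \<and> count_list w 1 = n) \<longleftrightarrow>
      (\<exists>t. ((\<lambda>r. 0), t) \<in> computes_rel T \<and> t 0 = int m \<and> t 1 = int n)" (is "?L \<longleftrightarrow> ?R") for m n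
  proof
    assume ?L
    then obtain w where w: "F w < 0" "count_list w 0 = m" "count_list w 1 = n"
      by (auto simp: s(2))
    then obtain l where "label ts w = label_code l" "((entry, \<lambda>r. 0), (l, regs ts w)) \<in> (move T)\<^sup>*"
      using label_reachable[of ts w] by (auto simp: F_neg ts)
    moreover have "l = exit"
      using \<open>label ts w = label_code l\<close> w(1) F_neg[of w] by (simp add: list_encode_eq del: list_encode.simps)
    ultimately show ?R
      using w F_neg[of w] by (auto simp: computes_rel_def intro!: exI[of _ "regs ts w"])
  next
    assume ?R
    then obtain t where t: "((entry, \<lambda>r. 0), (exit, t)) \<in> (move (set ts))\<^sup>*" "t 0 = int m" "t 1 = int n"
      by (auto simp: computes_rel_def ts)
    then obtain w where w: "w \<in> lists (transition_letters ts)" "errors ts w = 0"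
      "label ts w = label_code exit" "regs ts w = t"
      using trace_exists by blast
    \<comment> \<open>The trace contains no letter 0 or 1, so this idle prefix produces exactly the
      required multiplicities.\<close>
    let ?v = "replicate m 0 @ replicate n 1"
    have idle: "\<forall>x\<in>set ?v. x \<notin> transition_letters ts"
      by (auto simp: transition_letters_def)
    have counts: "count_list w 0 = 0" "count_list w 1 = 0"
      using w(1) by (auto simp: transition_letters_def count_list_0_iff)
    have rep: "count_list (replicate k a) b = (if a = b then k else 0)" for k and a b :: nat
      by (induction k) auto
    have "F (?v @ w) < 0" "count_list (?v @ w) 0 = m" "count_list (?v @ w) 1 = n"
      unfolding F_neg idle_prefix[OF idle] using w t counts by (auto simp: rep)
    moreover have "?v @ w \<in> lists ?A"
      using w(1) A by (auto intro: transition_letters_alphabet)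
    ultimately show ?L using s(2) by (intro bexI[of _ "?v @ w"]) auto
  qed
  have "represents ?A s (\<lambda>m n. \<exists>t. ((\<lambda>r. 0), t) \<in> computes_rel T \<and> t 0 = int m \<and> t 1 = int n)"
    unfolding represents_def by (intro conjI allI finite_alphabet A s(1) F_ge iff)
  then show ?thesis by blast
qed

text \<open>Runs start with all registers 0, so the inputs are guessed into registers 0 and 1. The
  program for \<open>f\<close> preserves them, and the history compares them with the letter counts
  at the end.\<close>

lemma recursive_history: "\<exists>\<Sigma> s. represents \<Sigma> s (\<lambda>m n. computes f [m, n] c)"
proof -
  obtain R where "implements f [0, 1] 2 3 R"
    using implementable[of f] by (rule implementableE[of f "[0, 1]" 3 2]) auto
  note R = implementsD[OF this]
  define S where "S = {(s, t). \<exists>n. t = s(0 := n)} O {(s, t). \<exists>n. t = s(1 := n)} O R O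
    {(s, t). s 2 = c \<and> t = s}"
  have "definable S"
    unfolding S_def using R(1) by (intro definable_relcomp definable_havoc definable_test_const)
  then obtain T where T: "flowchart T"
    "\<And>s t. (embed s, t) \<in> computes_rel T \<longleftrightarrow> (\<exists>s'. t = embed s' \<and> (s, s') \<in> S)"
    by (auto simp: definable_def realizable_def)
  have S: "(\<exists>t. ((\<lambda>r. 0), t) \<in> S \<and> t 0 = m \<and> t 1 = n) \<longleftrightarrow> computes f [m, n] c" (is "?L \<longleftrightarrow> ?R") for m n
  proof
    assume ?L
    then obtain a b t where t: "((\<lambda>r. 0)(0 := a, 1 := b), t) \<in> R" "t 2 = c" "t 0 = m" "t 1 = n"
      unfolding S_def by (auto simp: relcomp.simps)
    have "t 0 = a" "t 1 = b" using R(2)[OF t(1), of 0] R(2)[OF t(1), of 1] by auto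
    then show ?R using R(3)[OF t(1)] t(2-4) by simp
  next
    assume ?R
    then obtain t where t: "((\<lambda>r. 0)(0 := m, 1 := n), t) \<in> R" "t 2 = c"
      using R(4)[of "(\<lambda>r. 0)(0 := m, 1 := n)" c] by auto
    have "t 0 = m" "t 1 = n" using R(2)[OF t(1), of 0] R(2)[OF t(1), of 1] by auto
    moreover have "((\<lambda>r. 0), t) \<in> S"
      unfolding S_def using t(2)
      by (intro relcompI[OF _ relcompI[of "(\<lambda>r. 0)(0 := m)", OF _ relcompI[OF t(1)]]]) auto
    ultimately show ?L by blast
  qed
  have zero: "(\<lambda>r. 0) = embed (\<lambda>r. 0)" by (auto simp: embed_def)
  have "(\<exists>t. ((\<lambda>r. 0), t) \<in> computes_rel T \<and> t 0 = int m \<and> t 1 = int n) \<longleftrightarrow>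
      (\<exists>t. ((\<lambda>r. 0), t) \<in> S \<and> t 0 = m \<and> t 1 = n)" for m n
    unfolding zero T(2) by (auto simp: embed_def)
  then show ?thesis
    using flowchart_history[OF T(1)] by (simp only: S)
qed

section \<open>Diagonalization\<close>

definition computable :: "nat \<Rightarrow> (nat list \<Rightarrow> nat) \<Rightarrow> bool" where
  "computable k F \<longleftrightarrow> (\<exists>f. \<forall>xs. length xs = k \<longrightarrow> computes f xs (F xs))"

lemma computable_nth: "i < k \<Longrightarrow> computable k (\<lambda>xs. xs ! i)"
  unfolding computable_def by (metis computes.proj)

lemma computable_comp1:
  assumes "computable 1 F" "computable k G"
  shows "computable k (\<lambda>xs. F [G xs])"
proof -
  obtain f g where "\<And>xs. length xs = 1 \<Longrightarrow> computes f xs (F xs)"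
    "\<And>xs. length xs = k \<Longrightarrow> computes g xs (G xs)"
    using assms by (auto simp: computable_def)
  then have "\<forall>xs. length xs = k \<longrightarrow> computes (Comp f [g]) xs (F [G xs])"
    by (auto intro!: computes.comp[where ys = "[G _]"])
  then show ?thesis unfolding computable_def by blast
qed

lemma computable_comp2:
  assumes "computable 2 F" "computable k G" "computable k H"
  shows "computable k (\<lambda>xs. F [G xs, H xs])"
proof -
  obtain f g h where "\<And>xs. length xs = 2 \<Longrightarrow> computes f xs (F xs)"
    "\<And>xs. length xs = k \<Longrightarrow> computes g xs (G xs)"
    "\<And>xs. length xs = k \<Longrightarrow> computes h xs (H xs)"
    using assms by (auto simp: computable_def)
  then have "\<forall>xs. length xs = k \<longrightarrow> computes (Comp f [g, h]) xs (F [G xs, H xs])"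
    by (auto intro!: computes.comp[where ys = "[G _, H _]"])
  then show ?thesis unfolding computable_def by blast
qed

lemma computable_Suc:
  assumes "computable k G"
  shows "computable k (\<lambda>xs. Suc (G xs))"
proof -
  have "computable 1 (\<lambda>xs. Suc (hd xs))"
    unfolding computable_def by (auto simp: length_Suc_conv intro!: exI[of _ Succ] computes.succ)
  from computable_comp1[OF this assms] show ?thesis by simp
qed

lemma computable_const: "computable k (\<lambda>xs. c)"
proof (induction c)
  case 0
  show ?case unfolding computable_def using computes.zero by blast
next
  case (Suc c)
  then show ?case by (rule computable_Suc)
qed

lemma computable_primrec:
  assumes "computable k F" "computable (Suc (Suc k)) G"
    and "\<And>xs. length xs = k \<Longrightarrow> H (0 # xs) = F xs"
    and "\<And>n xs. length xs = k \<Longrightarrow> H (Suc n # xs) = G (n # H (n # xs) # xs)"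
  shows "computable (Suc k) H"
proof -
  obtain f g where f: "\<And>xs. length xs = k \<Longrightarrow> computes f xs (F xs)"
    and g: "\<And>xs. length xs = Suc (Suc k) \<Longrightarrow> computes g xs (G xs)"
    using assms(1,2) by (auto simp: computable_def)
  have "computes (PrimRec f g) (n # xs) (H (n # xs))" if "length xs = k" for n xs
  proof (induction n)
    case 0
    show ?case using f[OF that] assms(3)[OF that] by (auto intro: computes.primrec_0)
  next
    case (Suc n)
    show ?case
      unfolding assms(4)[OF that] using that by (intro computes.primrec_Suc[OF Suc] g) simp
  qed
  then have "\<forall>xs. length xs = Suc k \<longrightarrow> computes (PrimRec f g) xs (H xs)"
    by (auto simp: length_Suc_conv)
  then show ?thesis unfolding computable_def by blast
qed

lemma computable_add:
  assumes "computable k G" "computable k H"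
  shows "computable k (\<lambda>xs. G xs + H xs)"
proof -
  \<comment> \<open>In the step function, \<open>xs ! 0\<close> is the recursion index and
    \<open>xs ! 1\<close> the previous value.\<close>
  have "computable (Suc 1) (\<lambda>xs. xs ! 0 + xs ! 1)"
    by (rule computable_primrec[of 1 "\<lambda>xs. xs ! 0" "\<lambda>xs. Suc (xs ! 1)"])
      (auto intro: computable_nth computable_Suc)
  then have "computable 2 (\<lambda>xs. xs ! 0 + xs ! 1)" by (simp add: numeral_2_eq_2)
  from computable_comp2[OF this assms] show ?thesis by simp
qed

lemma computable_triangle:
  assumes "computable k G"
  shows "computable k (\<lambda>xs. triangle (G xs))"
proof -
  have "computable (Suc 0) (\<lambda>xs. triangle (xs ! 0))"
    by (rule computable_primrec[of 0 "\<lambda>xs. 0" "\<lambda>xs. xs ! 1 + Suc (xs ! 0)"])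
      (auto intro!: computable_const computable_nth computable_Suc computable_add)
  then have "computable 1 (\<lambda>xs. triangle (xs ! 0))" by simp
  from computable_comp1[OF this assms] show ?thesis by simp
qed

lemma computable_prod_encode:
  assumes "computable k G" "computable k H"
  shows "computable k (\<lambda>xs. prod_encode (G xs, H xs))"
  unfolding prod_encode_def using assms by (auto intro!: computable_add computable_triangle)

lemma computable_replicate:
  assumes "computable k G"
  shows "computable k (\<lambda>xs. list_encode (replicate (G xs) a))"
proof -
  \<comment> \<open>The code of \<open>a # l\<close> is
    \<open>Suc (prod_encode (a, list_encode l))\<close>, which is the recursion step.\<close>
  have "computable (Suc 0) (\<lambda>xs. list_encode (replicate (xs ! 0) a))"
    by (rule computable_primrec[of 0 "\<lambda>xs. 0" "\<lambda>xs. Suc (prod_encode (a, xs ! 1))"])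
      (auto intro!: computable_const computable_nth computable_Suc computable_prod_encode)
  then have "computable 1 (\<lambda>xs. list_encode (replicate (xs ! 0) a))" by simp
  from computable_comp1[OF this assms] show ?thesis by simp
qed

section \<open>Restriction of a history to prescribed letter counts\<close>

text \<open>
  For \<open>n > 0\<close> the penalty vanishes exactly on the words with \<open>n\<close> occurrences of \<open>a\<close>, as
  \<open>m choose n = 1\<close> only for \<open>m = n\<close> then.
\<close>

definition defect :: "nat \<Rightarrow> nat \<Rightarrow> nat subword_history" where
  "defect a n = Add (Monomial (replicate n a)) (Neg (Monomial []))"

definition penalty :: "nat \<Rightarrow> nat \<Rightarrow> nat subword_history" where
  "penalty a n = Mult (defect a n) (defect a n)"

lemma sh_value_penalty: "sh_value w (penalty a n) = (int (count_list w a choose n) - 1)\<^sup>2"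
  by (simp add: penalty_def defect_def subword_count_replicate subword_count_Nil power2_eq_square)

lemma letters_penalty: "a \<in> \<Sigma> \<Longrightarrow> letters (penalty a n) \<subseteq> \<Sigma>"
  by (auto simp: penalty_def defect_def)

lemma computable_penalty:
  assumes "computable k G"
  shows "computable k (\<lambda>xs. sh_encode (penalty a (G xs)))"
  unfolding penalty_def defect_def sh_encode.simps using assms
  by (intro computable_prod_encode computable_const computable_replicate)

text \<open>\<open>s\<close> enters as a subterm only, so the code of the result is computable from
  \<open>m\<close>, \<open>n\<close> and the code of \<open>s\<close>.\<close>

definition restrict :: "nat \<Rightarrow> nat \<Rightarrow> nat subword_history \<Rightarrow> nat subword_history" where
  "restrict m n s = Add s (Add (penalty 0 m) (penalty 1 n))"

text \<open>A nonzero penalty is at least 1 and lifts the value of \<open>s\<close>, which is at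
  least - 1, to a nonnegative one. Positivity of \<open>m\<close> and \<open>n\<close> makes the
  binomial tests exact.\<close>

lemma sh_value_restrict_less_0_iff:
  assumes "- 1 \<le> sh_value w s" "0 < m" "0 < n"
  shows "sh_value w (restrict m n s) < 0 \<longleftrightarrow>
    sh_value w s < 0 \<and> count_list w 0 = m \<and> count_list w 1 = n"
proof -
  have sum: "x + (a\<^sup>2 + b\<^sup>2) < 0 \<longleftrightarrow> x < 0 \<and> a = 0 \<and> b = 0" if "- 1 \<le> x" for x a b :: int
  proof
    assume "x + (a\<^sup>2 + b\<^sup>2) < 0"
    then have "x < 0 \<and> a\<^sup>2 = 0 \<and> b\<^sup>2 = 0"
      using that zero_le_power2[of a] zero_le_power2[of b] by linarith
    then show "x < 0 \<and> a = 0 \<and> b = 0" by simp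
  qed simp
  show ?thesis
    using choose_eq_1_iff[OF assms(2)] choose_eq_1_iff[OF assms(3)]
    by (simp add: restrict_def sh_value_penalty sum[OF assms(1)])
qed

theorem corollary1:
  "\<not> decidable_problem sh_instance_encode sh_instances SubwordIneqAbsoluteness"
proof
  assume "decidable_problem sh_instance_encode sh_instances SubwordIneqAbsoluteness"
  then obtain f where f: "\<And>x. x \<in> sh_instances \<Longrightarrow>
      computes f [sh_instance_encode x] (if SubwordIneqAbsoluteness x then 1 else 0)"
    unfolding decidable_problem_def by blast
  \<comment> \<open>If \<open>m\<close> is the code of an alphabet and \<open>n\<close> that of a
    history \<open>s\<close>, this is the code of the instance with history
    \<open>restrict m n s\<close>; the number 2 is the tag of \<open>Add\<close>.\<close>
  define D where "D m n = prod_encode (m, prod_encode (2, prod_encode (n,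
      prod_encode (2, prod_encode (sh_encode (penalty 0 m), sh_encode (penalty 1 n))))))" for m n
  have "computable 2 (\<lambda>xs. D (xs ! 0) (xs ! 1))"
    unfolding D_def
    by (intro computable_prod_encode computable_const computable_penalty computable_nth) simp_all
  then obtain d where d: "\<And>m n. computes d [m, n] (D m n)"
    unfolding computable_def by (metis length_Cons list.size(3) nth_Cons_0 nth_Cons_Suc
        One_nat_def numeral_2_eq_2)
  \<comment> \<open>Nothing is known about \<open>f\<close> outside the codes of instances, so
    \<open>h\<close> may be partial.\<close>
  define h where "h = Comp f [d]"
  have h: "computes h [m, n] 1 \<longleftrightarrow> computes f [D m n] 1" for m n
  proof
    assume "computes h [m, n] 1"
    then obtain y where "computes d [m, n] y" "computes f [y] 1"
      unfolding h_def by (auto elim!: computes_CompE simp: list_all2_Cons1)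
    then show "computes f [D m n] 1" using computes_functional[OF d] by blast
  next
    assume "computes f [D m n] 1"
    then show "computes h [m, n] 1"
      unfolding h_def using d by (intro computes.comp[of _ _ "[D m n]"]) auto
  qed
  obtain \<Sigma> s0 where s0: "represents \<Sigma> s0 (\<lambda>m n. computes h [m, n] 1)"
    using recursive_history by blast
  \<comment> \<open>Only \<open>Monomial []\<close> has code number 0; the double negation rules it out.\<close>
  define s where "s = Neg (Neg s0)"
  have "represents \<Sigma> s (\<lambda>m n. computes h [m, n] 1)"
    using s0 by (simp add: represents_def s_def)
  then have \<Sigma>: "finite \<Sigma>" "0 \<in> \<Sigma>" "1 \<in> \<Sigma>" and s: "letters s \<subseteq> \<Sigma>" "\<And>w. - 1 \<le> sh_value w s"
    and rep: "\<And>m n. (\<exists>w\<in>lists \<Sigma>. sh_value w s < 0 \<and> count_list w 0 = m \<and> count_list w 1 = n) \<longleftrightarrow>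
       computes h [m, n] 1"
    by (simp_all only: represents_def)
  \<comment> \<open>The diagonal choice: the history for \<open>h\<close> is restricted to the codes
    of its own alphabet and of itself.\<close>
  let ?m = "set_encode \<Sigma>" and ?n = "sh_encode s"
  let ?x = "(\<Sigma>, restrict ?m ?n s)"
  \<comment> \<open>Only the empty set has code 0.\<close>
  have "0 < ?m"
    using \<Sigma> by (auto simp: set_encode_def sum_eq_0_iff intro!: Nat.gr0I)
  have "0 < ?n"
    by (simp add: s_def prod_encode_def)
  have "?x \<in> sh_instances"
    using \<Sigma> s(1) letters_penalty by (auto simp: sh_instances_def restrict_def)
  then have "computes f [sh_instance_encode ?x] (if SubwordIneqAbsoluteness ?x then 1 else 0)"
    by (rule f)
  then have "SubwordIneqAbsoluteness ?x \<longleftrightarrow> computes f [sh_instance_encode ?x] 1"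
    using computes_functional by (fastforce split: if_splits)
  also have "sh_instance_encode ?x = D ?m ?n"
    by (simp add: sh_instance_encode_def restrict_def D_def)
  \<comment> \<open>The answer 1 means \<open>h\<close> has value 1 at \<open>(?m, ?n)\<close>, so
    some word with these letter counts makes \<open>s\<close> negative; that is exactly a word on
    which the restricted history is negative.\<close>
  also have "computes f [D ?m ?n] 1 \<longleftrightarrow> \<not> SubwordIneqAbsoluteness ?x"
    unfolding h[symmetric] rep[symmetric] SubwordIneqAbsoluteness_def
    using sh_value_restrict_less_0_iff[OF s(2) \<open>0 < ?m\<close> \<open>0 < ?n\<close>] by force
  finally show False by blast
qed

end
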